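(* The operators $\mathcal L_h^c$ and $\mathcal L_h^d$ and their inverses are bounded uniformly in $h$. Precisely: the operator norms of $$\mathcal L_h^c:\ S_h\times\boldsymbol U_h\to S_h'\times\boldsymbol U_h',\qquad \mathcal L_h^d:\ \boldsymbol U_h\times\boldsymbol V_h\to\boldsymbol U_h'\times\boldsymbol V_h'$$ from the norms $(\|\cdot\|_M,\|\cdot\|_A)$ to the norms $(\|\cdot\|_{M^{-1}},\|\cdot\|_{A^{-1}})$ are bounded by constants independent of $h$, and the operator norms of $$(\mathcal L_h^c)^{-1}:\ S_h'\times\boldsymbol U_h'\to S_h\times\boldsymbol U_h,\qquad(\mathcal L_h^d)^{-1}:\ \boldsymbol U_h'\times\boldsymbol V_h'\to\boldsymbol U_h\times\boldsymbol V_h$$ from $(\|\cdot\|_{M^{-1}},\|\cdot\|_{A^{-1}})$ to $(\|\cdot\|_M,\|\cdot\|_A)$ are bounded by constants independent of $h$.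
   Context: Setting. $\Omega\subset\mathbb R^3$ is a bounded convex polyhedron homeomorphic to a ball, $(\cdot,\cdot)$ is the $L^2(\Omega)$ inner product, and $\mathcal T_h$ is a mesh of size $h$ from a shape-regular quasi-uniform family. $S_h\subset H^1_0$ (Lagrange elements), $\boldsymbol U_h\subset\boldsymbol H_0(\mathrm{curl})$ (edge elements), $\boldsymbol V_h\subset\boldsymbol H_0(\mathrm{div})$ (face elements), $W_h\subset L_0^2$ (discontinuous piecewise polynomials) are finite element spaces on $\mathcal T_h$ such that $0\to S_h\xrightarrow{\mathrm{grad}}\boldsymbol U_h\xrightarrow{\mathrm{curl}}\boldsymbol V_h\xrightarrow{\mathrm{div}}W_h\to0$ is exact. Primes denote dual spaces and $\langle\cdot,\cdot\rangle$ the duality pairing. Curl case: $\langle M_v\sigma,\tau\rangle=(\sigma,\tau)$ for $\sigma,\tau\in S_h$; $B:\boldsymbol U_h\to S_h'$, $\langle B\boldsymbol u,\tau\rangle=(\boldsymbol u,\mathrm{grad}\,\tau)$; $C^TM_fC:\boldsymbol U_h\to\boldsymbol U_h'$, $\langle C^TM_fC\boldsymbol u,\boldsymbol v\rangle=(\mathrm{curl}\,\boldsymbol u,\mathrm{curl}\,\boldsymbol v)$. Then $$\mathcal L_h^c=\begin{pmatrix} -M_v & B \\ B^T & C^TM_fC \end{pmatrix},\qquad A_h^c=B^TM_v^{-1}B+C^TM_fC.$$ Div case: $\langle M_e\boldsymbol\sigma,\boldsymbol\tau\rangle=(\boldsymbol\sigma,\boldsymbol\tau)$ for $\boldsymbol\sigma,\boldsymbol\tau\in\boldsymbol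 U_h$; here $C:\boldsymbol U_h\to\boldsymbol V_h'$, $\langle C\boldsymbol\sigma,\boldsymbol v\rangle=(\mathrm{curl}\,\boldsymbol\sigma,\boldsymbol v)$; and $B^TM_tB:\boldsymbol V_h\to\boldsymbol V_h'$, $\langle B^TM_tB\boldsymbol u,\boldsymbol v\rangle=(\mathrm{div}\,\boldsymbol u,\mathrm{div}\,\boldsymbol v)$. Then $$\mathcal L_h^d=\begin{pmatrix} -M_e & C^T \\ C & B^TM_tB \end{pmatrix},\qquad A_h^d=CM_e^{-1}C^T+B^TM_tB.$$ With $M=M_v$, $A=A_h^c$ in the curl case and $M=M_e$, $A=A_h^d$ in the div case, the norms are $\|\sigma\|_M^2=\langle M\sigma,\sigma\rangle$, $\|u\|_A^2=\langle Au,u\rangle$, and on the duals $\|g\|_{M^{-1}}^2=\langle M^{-1}g,g\rangle$, $\|f\|_{A^{-1}}^2=\langle A^{-1}f,f\rangle$. A pair of norms $(\|\cdot\|_1,\|\cdot\|_2)$ on a product space means the product norm, e.g. $\|x\|_1+\|y\|_2$. The matrices $M_v,M_e,A_h^c,A_h^d$ are symmetric positive definite. *)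

theory Defs
  imports "HOL-Analysis.Analysis"
begin

section \<open>Domains and meshes\<close>

type_synonym mesh = "(real^3) set set"

text \<open>Domains are open; polyhedra in the library are closed, hence the closure.\<close>

definition convex_polyhedral_domain :: "(real^3) set \<Rightarrow> bool" where
  "convex_polyhedral_domain \<Omega> \<longleftrightarrow>
     open \<Omega> \<and> \<Omega> \<noteq> {} \<and> bounded \<Omega> \<and> convex \<Omega> \<and> polyhedron (closure \<Omega>) \<and>
     \<Omega> homeomorphic ball (0 :: real^3) 1"

definition mesh_of :: "(real^3) set \<Rightarrow> mesh \<Rightarrow> bool" where
  "mesh_of \<Omega> T \<longleftrightarrow> triangulation T \<and> (\<forall>K\<in>T. 3 simplex K) \<and> \<Union>T = closure \<Omega>"

definition mesh_size :: "mesh \<Rightarrow> real" where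
  "mesh_size T = Max (diameter ` T)"

definition inscribed_diameter :: "(real^3) set \<Rightarrow> real" where
  "inscribed_diameter K = 2 * Sup {\<rho>. 0 \<le> \<rho> \<and> (\<exists>c. cball c \<rho> \<subseteq> K)}"

definition regular_mesh_family :: "(real^3) set \<Rightarrow> real set \<Rightarrow> (real \<Rightarrow> mesh) \<Rightarrow> bool" where
  "regular_mesh_family \<Omega> H T \<longleftrightarrow>
     (\<forall>h\<in>H. mesh_of \<Omega> (T h) \<and> mesh_size (T h) = h) \<and>
     \<comment> \<open>shape regularity\<close>
     (\<exists>\<kappa>. \<forall>h\<in>H. \<forall>K\<in>T h. diameter K \<le> \<kappa> * inscribed_diameter K) \<and>
     \<comment> \<open>quasi-uniformity\<close>
     (\<exists>\<gamma>>0. \<forall>h\<in>H. \<forall>K\<in>T h. \<gamma> * h \<le> diameter K)"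

section \<open>Differential operators\<close>

definition pd :: "3 \<Rightarrow> (real^3 \<Rightarrow> real) \<Rightarrow> real^3 \<Rightarrow> real" where
  "pd i f x = frechet_derivative f (at x) (axis i 1)"

definition grad :: "(real^3 \<Rightarrow> real) \<Rightarrow> real^3 \<Rightarrow> real^3" where
  "grad f x = (\<chi> i. pd i f x)"

definition curl :: "(real^3 \<Rightarrow> real^3) \<Rightarrow> real^3 \<Rightarrow> real^3" where
  "curl u x = vector
     [pd 2 (\<lambda>y. u y $ 3) x - pd 3 (\<lambda>y. u y $ 2) x,
      pd 3 (\<lambda>y. u y $ 1) x - pd 1 (\<lambda>y. u y $ 3) x,
      pd 1 (\<lambda>y. u y $ 2) x - pd 2 (\<lambda>y. u y $ 1) x]"

definition divg :: "(real^3 \<Rightarrow> real^3) \<Rightarrow> real^3 \<Rightarrow> real" where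
  "divg u x = (\<Sum>i\<in>UNIV. pd i (\<lambda>y. u y $ i) x)"

section \<open>\<open>L\<^sup>2\<close> and the Sobolev spaces with vanishing traces\<close>

definition l2 :: "(real^3) set \<Rightarrow> (real^3 \<Rightarrow> 'v::euclidean_space) \<Rightarrow> (real^3 \<Rightarrow> 'v) \<Rightarrow> real" where
  "l2 \<Omega> f g = (LINT x:\<Omega>|lborel. f x \<bullet> g x)"

definition L2 :: "(real^3) set \<Rightarrow> (real^3 \<Rightarrow> 'v::euclidean_space) \<Rightarrow> bool" where
  "L2 \<Omega> f \<longleftrightarrow> set_borel_measurable lborel \<Omega> f \<and> set_integrable lborel \<Omega> (\<lambda>x. f x \<bullet> f x)"

definition L2_tendsto ::
  "(real^3) set \<Rightarrow> (nat \<Rightarrow> real^3 \<Rightarrow> 'v::euclidean_space) \<Rightarrow> (real^3 \<Rightarrow> 'v) \<Rightarrow> bool" where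
  "L2_tendsto \<Omega> f u \<longleftrightarrow>
     L2 \<Omega> u \<and> (\<forall>n. L2 \<Omega> (f n)) \<and>
     (\<lambda>n. l2 \<Omega> (\<lambda>x. f n x - u x) (\<lambda>x. f n x - u x)) \<longlonglongrightarrow> 0"

text \<open>Infinitely differentiable: all iterated partial derivatives exist and are differentiable.\<close>

definition smooth :: "(real^3 \<Rightarrow> real) \<Rightarrow> bool" where
  "smooth f \<longleftrightarrow> (\<forall>is x. foldr pd is f differentiable (at x))"

definition test_function :: "(real^3) set \<Rightarrow> (real^3 \<Rightarrow> real) \<Rightarrow> bool" where
  "test_function \<Omega> \<phi> \<longleftrightarrow>
     smooth \<phi> \<and> compact (closure {x. \<phi> x \<noteq> 0}) \<and> closure {x. \<phi> x \<noteq> 0} \<subseteq> \<Omega>"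

definition test_field :: "(real^3) set \<Rightarrow> (real^3 \<Rightarrow> real^3) \<Rightarrow> bool" where
  "test_field \<Omega> \<phi> \<longleftrightarrow> (\<forall>i. test_function \<Omega> (\<lambda>x. \<phi> x $ i))"

text \<open>
  The spaces \<open>H\<^sup>1\<^sub>0\<close>, \<open>H\<^sub>0(curl)\<close>, \<open>H\<^sub>0(div)\<close> are the closures of the compactly
  supported smooth functions in the respective graph norms.  The relations below say that the
  first function lies in the space and that the second one is its weak gradient, curl or
  divergence.
\<close>

definition H1_0_grad :: "(real^3) set \<Rightarrow> (real^3 \<Rightarrow> real) \<Rightarrow> (real^3 \<Rightarrow> real^3) \<Rightarrow> bool" where
  "H1_0_grad \<Omega> v g \<longleftrightarrow>
     (\<exists>\<phi>. (\<forall>n. test_function \<Omega> (\<phi> n)) \<and>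
          L2_tendsto \<Omega> \<phi> v \<and> L2_tendsto \<Omega> (\<lambda>n. grad (\<phi> n)) g)"

definition H0_curl :: "(real^3) set \<Rightarrow> (real^3 \<Rightarrow> real^3) \<Rightarrow> (real^3 \<Rightarrow> real^3) \<Rightarrow> bool" where
  "H0_curl \<Omega> u w \<longleftrightarrow>
     (\<exists>\<phi>. (\<forall>n. test_field \<Omega> (\<phi> n)) \<and>
          L2_tendsto \<Omega> \<phi> u \<and> L2_tendsto \<Omega> (\<lambda>n. curl (\<phi> n)) w)"

definition H0_div :: "(real^3) set \<Rightarrow> (real^3 \<Rightarrow> real^3) \<Rightarrow> (real^3 \<Rightarrow> real) \<Rightarrow> bool" where
  "H0_div \<Omega> v d \<longleftrightarrow>
     (\<exists>\<phi>. (\<forall>n. test_field \<Omega> (\<phi> n)) \<and>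
          L2_tendsto \<Omega> \<phi> v \<and> L2_tendsto \<Omega> (\<lambda>n. divg (\<phi> n)) d)"

section \<open>Finite element spaces\<close>

definition polys :: "nat \<Rightarrow> (real^3 \<Rightarrow> real) set" where
  "polys k = {p. \<exists>c :: nat \<Rightarrow> nat \<Rightarrow> nat \<Rightarrow> real. \<forall>x.
     p x = (\<Sum>i\<le>k. \<Sum>j\<le>k - i. \<Sum>l\<le>k - i - j. c i j l * (x$1)^i * (x$2)^j * (x$3)^l)}"

definition vpolys :: "nat \<Rightarrow> (real^3 \<Rightarrow> real^3) set" where
  "vpolys k = {p. \<forall>i. (\<lambda>x. p x $ i) \<in> polys k}"

text \<open>
  Both families of edge and of face elements, each with degree \<open>k \<ge> 1\<close>: the first
  (Nedelec, Raviart-Thomas) contains the polynomial fields of degree \<open>k - 1\<close>,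
  the second (Nedelec, Brezzi-Douglas-Marini) all fields of degree \<open>k\<close>.
\<close>

datatype edge_element = Nedelec_first nat | Nedelec_second nat

datatype face_element = Raviart_Thomas nat | Brezzi_Douglas_Marini nat

fun edge_degree :: "edge_element \<Rightarrow> nat" where
  "edge_degree (Nedelec_first k) = k"
| "edge_degree (Nedelec_second k) = k"

fun face_degree :: "face_element \<Rightarrow> nat" where
  "face_degree (Raviart_Thomas k) = k"
| "face_degree (Brezzi_Douglas_Marini k) = k"

fun edge_polys :: "edge_element \<Rightarrow> (real^3 \<Rightarrow> real^3) set" where
  "edge_polys (Nedelec_first k) =
     {p. \<exists>a\<in>vpolys (k - 1). \<exists>b\<in>vpolys (k - 1). \<forall>x. p x = a x + cross3 x (b x)}"
| "edge_polys (Nedelec_second k) = vpolys k"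

fun face_polys :: "face_element \<Rightarrow> (real^3 \<Rightarrow> real^3) set" where
  "face_polys (Raviart_Thomas k) =
     {p. \<exists>a\<in>vpolys (k - 1). \<exists>q\<in>polys (k - 1). \<forall>x. p x = a x + q x *\<^sub>R x}"
| "face_polys (Brezzi_Douglas_Marini k) = vpolys k"

text \<open>
  A piecewise polynomial is an \<open>L\<^sup>2\<close> class.  It is represented by the member of the class that
  is a polynomial on every open cell and zero off the open cells (a null set in the domain), so
  that equality of functions is equality of classes.
\<close>

definition open_cells :: "mesh \<Rightarrow> (real^3) set" where
  "open_cells T = (\<Union>K\<in>T. interior K)"

definition piecewise ::
  "mesh \<Rightarrow> (real^3 \<Rightarrow> 'v::zero) set \<Rightarrow> (real^3 \<Rightarrow> 'v) set" where
  "piecewise T P =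
     {u. (\<forall>K\<in>T. \<exists>p\<in>P. \<forall>x\<in>interior K. u x = p x) \<and> (\<forall>x. x \<notin> open_cells T \<longrightarrow> u x = 0)}"

definition elementwise ::
  "mesh \<Rightarrow> ('f \<Rightarrow> real^3 \<Rightarrow> 'v::zero) \<Rightarrow> 'f \<Rightarrow> real^3 \<Rightarrow> 'v" where
  "elementwise T D u x = (if x \<in> open_cells T then D u x else 0)"

abbreviation "grad_h T \<equiv> elementwise T grad"
abbreviation "curl_h T \<equiv> elementwise T curl"
abbreviation "div_h T \<equiv> elementwise T divg"

text \<open>
  The weak derivative of a conforming piecewise polynomial is the elementwise classical one; the
  conformity conditions below express membership in the Sobolev space together with this, so
  that \<open>grad_h\<close>, \<open>curl_h\<close>, \<open>div_h\<close> are the weak operators on these spaces.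
\<close>

definition lagrange_space :: "(real^3) set \<Rightarrow> mesh \<Rightarrow> nat \<Rightarrow> (real^3 \<Rightarrow> real) set" where
  "lagrange_space \<Omega> T r = {v \<in> piecewise T (polys r). H1_0_grad \<Omega> v (grad_h T v)}"

definition edge_space :: "(real^3) set \<Rightarrow> mesh \<Rightarrow> edge_element \<Rightarrow> (real^3 \<Rightarrow> real^3) set" where
  "edge_space \<Omega> T e = {u \<in> piecewise T (edge_polys e). H0_curl \<Omega> u (curl_h T u)}"

definition face_space :: "(real^3) set \<Rightarrow> mesh \<Rightarrow> face_element \<Rightarrow> (real^3 \<Rightarrow> real^3) set" where
  "face_space \<Omega> T f = {v \<in> piecewise T (face_polys f). H0_div \<Omega> v (div_h T v)}"

definition dg_space :: "(real^3) set \<Rightarrow> mesh \<Rightarrow> nat \<Rightarrow> (real^3 \<Rightarrow> real) set" where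
  "dg_space \<Omega> T s = {w \<in> piecewise T (polys s). (LINT x:\<Omega>|lborel. w x) = 0}"

definition exact_complex ::
  "mesh \<Rightarrow> (real^3 \<Rightarrow> real) set \<Rightarrow> (real^3 \<Rightarrow> real^3) set \<Rightarrow> (real^3 \<Rightarrow> real^3) set \<Rightarrow>
   (real^3 \<Rightarrow> real) set \<Rightarrow> bool" where
  "exact_complex T S U V W \<longleftrightarrow>
     inj_on (grad_h T) S \<and>
     grad_h T ` S = {u \<in> U. curl_h T u = (\<lambda>x. 0)} \<and>
     curl_h T ` U = {v \<in> V. div_h T v = (\<lambda>x. 0)} \<and>
     div_h T ` V = W"

section \<open>Dual spaces and operators\<close>

text \<open>Functionals on a subspace \<open>X\<close> are extended by zero off \<open>X\<close>; this makes them unique.\<close>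

definition functional :: "'f set \<Rightarrow> ('f \<Rightarrow> real) \<Rightarrow> 'f \<Rightarrow> real" where
  "functional X g x = (if x \<in> X then g x else 0)"

definition dual :: "('p \<Rightarrow> 'v::real_vector) set \<Rightarrow> (('p \<Rightarrow> 'v) \<Rightarrow> real) set" where
  "dual X = {g.
     (\<forall>x\<in>X. \<forall>y\<in>X. g (\<lambda>p. x p + y p) = g x + g y) \<and>
     (\<forall>c. \<forall>x\<in>X. g (\<lambda>p. c *\<^sub>R x p) = c * g x) \<and>
     (\<forall>x. x \<notin> X \<longrightarrow> g x = 0)}"

text \<open>For \<open>B\<close> from \<open>X\<close> to the dual of \<open>Y\<close>, \<open>transp X B\<close> maps \<open>Y\<close> to the dual of \<open>X\<close>.\<close>

definition transp :: "'f set \<Rightarrow> ('f \<Rightarrow> 'g \<Rightarrow> real) \<Rightarrow> 'g \<Rightarrow> 'f \<Rightarrow> real" where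
  "transp X B y = functional X (\<lambda>x. B x y)"

definition saddle ::
  "('f \<Rightarrow> 'f \<Rightarrow> real) \<Rightarrow> ('g \<Rightarrow> 'f \<Rightarrow> real) \<Rightarrow> ('f \<Rightarrow> 'g \<Rightarrow> real) \<Rightarrow> ('g \<Rightarrow> 'g \<Rightarrow> real) \<Rightarrow>
   'f \<times> 'g \<Rightarrow> ('f \<Rightarrow> real) \<times> ('g \<Rightarrow> real)" where
  "saddle M B12 B21 D = (\<lambda>(\<sigma>, u). (\<lambda>\<tau>. - M \<sigma> \<tau> + B12 u \<tau>, \<lambda>v. B21 \<sigma> v + D u v))"

text \<open>\<open>B21 M\<^sup>-\<^sup>1 B12 + D\<close>, where \<open>M\<close> maps \<open>X\<close> to its dual\<close>

definition schur ::
  "'f set \<Rightarrow> ('f \<Rightarrow> 'f \<Rightarrow> real) \<Rightarrow> ('g \<Rightarrow> 'f \<Rightarrow> real) \<Rightarrow> ('f \<Rightarrow> 'g \<Rightarrow> real) \<Rightarrow> ('g \<Rightarrow> 'g \<Rightarrow> real) \<Rightarrow>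
   'g \<Rightarrow> 'g \<Rightarrow> real" where
  "schur X M B12 B21 D u v = B21 (inv_into X M (B12 u)) v + D u v"

text \<open>\<open>M\<^sub>v\<close> for \<open>X = S\<^sub>h\<close> and \<open>M\<^sub>e\<close> for \<open>X = U\<^sub>h\<close>\<close>

definition mass ::
  "(real^3) set \<Rightarrow> (real^3 \<Rightarrow> 'v::euclidean_space) set \<Rightarrow> (real^3 \<Rightarrow> 'v) \<Rightarrow> (real^3 \<Rightarrow> 'v) \<Rightarrow> real"
  where
  "mass \<Omega> X \<sigma> = functional X (\<lambda>\<tau>. l2 \<Omega> \<sigma> \<tau>)"

definition B_op where
  "B_op \<Omega> T S u = functional S (\<lambda>\<tau>. l2 \<Omega> u (grad_h T \<tau>))"

definition curl_curl where
  "curl_curl \<Omega> T U u = functional U (\<lambda>v. l2 \<Omega> (curl_h T u) (curl_h T v))"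

definition C_op where
  "C_op \<Omega> T V \<sigma> = functional V (\<lambda>v. l2 \<Omega> (curl_h T \<sigma>) v)"

definition div_div where
  "div_div \<Omega> T V u = functional V (\<lambda>v. l2 \<Omega> (div_h T u) (div_h T v))"

definition L_curl where
  "L_curl \<Omega> T S U =
     saddle (mass \<Omega> S) (B_op \<Omega> T S) (transp U (B_op \<Omega> T S)) (curl_curl \<Omega> T U)"

definition A_curl where
  "A_curl \<Omega> T S U =
     schur S (mass \<Omega> S) (B_op \<Omega> T S) (transp U (B_op \<Omega> T S)) (curl_curl \<Omega> T U)"

definition L_div where
  "L_div \<Omega> T U V =
     saddle (mass \<Omega> U) (transp U (C_op \<Omega> T V)) (C_op \<Omega> T V) (div_div \<Omega> T V)"

definition A_div where
  "A_div \<Omega> T U V =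
     schur U (mass \<Omega> U) (transp U (C_op \<Omega> T V)) (C_op \<Omega> T V) (div_div \<Omega> T V)"

section \<open>Norms\<close>

definition energy_norm :: "('f \<Rightarrow> 'f \<Rightarrow> real) \<Rightarrow> 'f \<Rightarrow> real" where
  "energy_norm A u = sqrt (A u u)"

definition dual_norm :: "'f set \<Rightarrow> ('f \<Rightarrow> 'f \<Rightarrow> real) \<Rightarrow> ('f \<Rightarrow> real) \<Rightarrow> real" where
  "dual_norm X A g = sqrt (g (inv_into X A g))"

definition pair_norm :: "('f \<Rightarrow> real) \<Rightarrow> ('g \<Rightarrow> real) \<Rightarrow> 'f \<times> 'g \<Rightarrow> real" where
  "pair_norm N1 N2 = (\<lambda>(x, y). N1 x + N2 y)"

text \<open>The operator norm of \<open>L\<close> on \<open>X\<close>, from the norm \<open>N\<close> to the norm \<open>N'\<close>, is at most \<open>C\<close>.\<close>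

definition op_norm_le :: "'x set \<Rightarrow> ('x \<Rightarrow> real) \<Rightarrow> ('y \<Rightarrow> real) \<Rightarrow> ('x \<Rightarrow> 'y) \<Rightarrow> real \<Rightarrow> bool" where
  "op_norm_le X N N' L C \<longleftrightarrow> (\<forall>x\<in>X. N' (L x) \<le> C * N x)"

end

theory Submission
  imports Defs "HOL-Library.Function_Algebras"
begin

text \<open>
  Both operators have the form \<open>L (\<sigma>, u) = (- M \<sigma> + B u, B\<^sup>T \<sigma> + D u)\<close>, and the whole theorem
  rests on the block factorization obtained from \<open>\<rho> = \<sigma> - M\<^sup>-\<^sup>1 B u\<close>:
  \<open>L (\<sigma>, u) = (- M \<rho>, A u + B\<^sup>T \<rho>)\<close> with the Schur complement \<open>A = B\<^sup>T M\<^sup>-\<^sup>1 B + D\<close>.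
  In the given norms \<open>M\<close> and \<open>A\<close> are isometries onto the duals, and the two coupling
  terms are contractions: since \<open>\<langle>A u, u\<rangle> = \<parallel>M\<^sup>-\<^sup>1 B u\<parallel>\<^sup>2 + \<langle>D u, u\<rangle>\<close>, the norm of \<open>M\<^sup>-\<^sup>1 B u\<close> is
  at most that of \<open>u\<close>, and dually \<open>B\<^sup>T\<close> has norm at most one.  Hence both \<open>L\<close> and its inverse,
  which is read off by back substitution, have norm at most 3.  The constant comes from the
  algebra alone, so it is independent of the mesh.  This is the locale \<open>saddle_system\<close>.

  What remains is to see that \<open>M\<close> and \<open>A\<close> are symmetric positive definite on
  finite-dimensional spaces, so that the Riesz lemma makes them bijections onto the duals.  For
  \<open>A\<close> this is where exactness enters (\<open>hodge_saddle_system\<close>): if \<open>\<langle>A u, u\<rangle> = 0\<close>, then \<open>D u\<close>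
  vanishes, so \<open>u\<close> is closed, hence \<open>u\<close> is a gradient (a curl), and \<open>B u = 0\<close> says that \<open>u\<close> is
  orthogonal to all discrete gradients (curls), in particular to itself.

  The finite element part (\<open>conforming_fe_space\<close>) checks that the conforming spaces are
  finite-dimensional subspaces of \<open>L\<^sup>2\<close>, that the elementwise operators are linear on them, and
  that the \<open>L\<^sup>2\<close> form is definite: a piecewise polynomial of zero norm vanishes almost everywhere
  and is continuous on the open cells, so it vanishes identically.
\<close>

section \<open>Functions as a real vector space\<close>

instantiation "fun" :: (type, real_vector) real_vector
begin

definition scaleR_fun :: "real \<Rightarrow> ('a \<Rightarrow> 'b) \<Rightarrow> 'a \<Rightarrow> 'b" where
  "scaleR_fun c f = (\<lambda>x. c *\<^sub>R f x)"

instance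
  by standard (simp_all add: scaleR_fun_def fun_eq_iff scaleR_add_right scaleR_add_left)

end

lemma scaleR_fun_apply [simp]: "(c *\<^sub>R f) x = c *\<^sub>R f x"
  by (simp add: scaleR_fun_def)

section \<open>Symmetric positive definite forms on finite-dimensional spaces\<close>

lemma dual_iff:
  "g \<in> dual X \<longleftrightarrow>
     (\<forall>x\<in>X. \<forall>y\<in>X. g (x + y) = g x + g y) \<and>
     (\<forall>c. \<forall>x\<in>X. g (c *\<^sub>R x) = c * g x) \<and>
     (\<forall>x. x \<notin> X \<longrightarrow> g x = 0)"
  by (simp add: dual_def plus_fun_def scaleR_fun_def)

lemma dualI:
  assumes "\<And>x y. x \<in> X \<Longrightarrow> y \<in> X \<Longrightarrow> g (x + y) = g x + g y"
    and "\<And>c x. x \<in> X \<Longrightarrow> g (c *\<^sub>R x) = c * g x"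
    and "\<And>x. x \<notin> X \<Longrightarrow> g x = 0"
  shows "g \<in> dual X"
  using assms by (auto simp: dual_iff)

lemma dual_add: "g \<in> dual X \<Longrightarrow> x \<in> X \<Longrightarrow> y \<in> X \<Longrightarrow> g (x + y) = g x + g y"
  and dual_scale: "g \<in> dual X \<Longrightarrow> x \<in> X \<Longrightarrow> g (c *\<^sub>R x) = c * g x"
  and dual_off: "g \<in> dual X \<Longrightarrow> x \<notin> X \<Longrightarrow> g x = 0"
  by (auto simp: dual_iff)

lemma subspace_dual: "subspace X \<Longrightarrow> subspace (dual X)"
  unfolding subspace_def
  by (auto intro!: dualI simp: dual_add dual_scale dual_off algebra_simps)

lemma dual_eqI:
  assumes "g \<in> dual X" "g' \<in> dual X" "\<And>x. x \<in> X \<Longrightarrow> g x = g' x"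
  shows "g = g'"
proof (rule ext)
  fix x show "g x = g' x"
    using assms dual_off[of g X x] dual_off[of g' X x] by (cases "x \<in> X") auto
qed

lemma dual_zero: "subspace X \<Longrightarrow> g \<in> dual X \<Longrightarrow> g 0 = 0"
  using dual_scale[of g X 0 0] subspace_0[of X] by simp

lemma dual_diff:
  assumes "subspace X" "g \<in> dual X" "x \<in> X" "y \<in> X"
  shows "g (x - y) = g x - g y"
  using dual_add[OF assms(2,3) subspace_scale[OF assms(1,4)], of "-1"]
    dual_scale[OF assms(2,4), of "-1"] by simp

lemma dual_sum:
  assumes "subspace X" "g \<in> dual X" "\<And>i. i \<in> I \<Longrightarrow> f i \<in> X"
  shows "g (sum f I) = (\<Sum>i\<in>I. g (f i))"
  using assms(3)
proof (induction I rule: infinite_finite_induct)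
  case (insert i I)
  then have "sum f I \<in> X" using assms(1) by (intro subspace_sum) auto
  then have "g (f i + sum f I) = g (f i) + g (sum f I)"
    using insert.prems by (intro dual_add[OF assms(2)]) auto
  then have "g (sum f (insert i I)) = g (f i) + g (sum f I)"
    by (simp only: sum.insert[OF insert.hyps])
  also have "g (sum f I) = (\<Sum>i\<in>I. g (f i))" using insert.IH insert.prems by blast
  finally show ?case by (simp only: sum.insert[OF insert.hyps])
qed (simp_all only: sum.empty sum.infinite dual_zero[OF assms(1,2)] simp_thms)

lemma dual_lincomb:
  assumes "subspace X" "g \<in> dual X" "I \<subseteq> X"
  shows "g (\<Sum>x\<in>I. c x *\<^sub>R x) = (\<Sum>x\<in>I. c x * g x)"
proof -
  have "g (\<Sum>x\<in>I. c x *\<^sub>R x) = (\<Sum>x\<in>I. g (c x *\<^sub>R x))"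
    using assms by (intro dual_sum[of X]) (blast intro: subspace_scale)+
  also have "\<dots> = (\<Sum>x\<in>I. c x * g x)"
    using assms by (intro sum.cong dual_scale[of g X]) auto
  finally show ?thesis .
qed

definition finite_dimensional :: "'a::real_vector set \<Rightarrow> bool" where
  "finite_dimensional X \<longleftrightarrow> (\<exists>G. finite G \<and> X \<subseteq> span G)"

text \<open>
  The form is curried, \<open>a x\<close> being the functional \<open>y \<mapsto> a x y\<close>, so that \<open>a\<close> itself is the operator
  from \<open>X\<close> to its dual.  Its linearity follows from symmetry.
\<close>

locale spd_form =
  fixes X :: "('p \<Rightarrow> 'v::real_vector) set" and a
  assumes subspace: "subspace X"
    and finite_dim: "finite_dimensional X"
    and in_dual: "x \<in> X \<Longrightarrow> a x \<in> dual X"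
    and sym: "x \<in> X \<Longrightarrow> y \<in> X \<Longrightarrow> a x y = a y x"
    and nonneg: "x \<in> X \<Longrightarrow> 0 \<le> a x x"
    and definite: "x \<in> X \<Longrightarrow> a x x = 0 \<Longrightarrow> x = 0"
begin

lemma X_add: "x \<in> X \<Longrightarrow> y \<in> X \<Longrightarrow> x + y \<in> X"
  and X_scale: "x \<in> X \<Longrightarrow> c *\<^sub>R x \<in> X"
  and X_diff: "x \<in> X \<Longrightarrow> y \<in> X \<Longrightarrow> x - y \<in> X"
  and X_0: "0 \<in> X"
  using subspace by (simp_all add: subspace_add subspace_scale subspace_diff subspace_0)

lemma add_left:
  assumes "x \<in> X" "y \<in> X"
  shows "a (x + y) = a x + a y"
proof (rule dual_eqI)
  show "a (x + y) \<in> dual X" by (intro in_dual X_add assms)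
  show "a x + a y \<in> dual X"
    by (intro subspace_add[OF subspace_dual[OF subspace]] in_dual assms)
  fix z assume z: "z \<in> X"
  show "a (x + y) z = (a x + a y) z"
    using z assms dual_add[OF in_dual[OF z] assms] by (simp add: sym[OF _ z] X_add)
qed

lemma scale_left:
  assumes "x \<in> X"
  shows "a (c *\<^sub>R x) = c *\<^sub>R a x"
proof (rule dual_eqI)
  show "a (c *\<^sub>R x) \<in> dual X" by (intro in_dual X_scale assms)
  show "c *\<^sub>R a x \<in> dual X"
    by (intro subspace_scale[OF subspace_dual[OF subspace]] in_dual assms)
  fix z assume z: "z \<in> X"
  show "a (c *\<^sub>R x) z = (c *\<^sub>R a x) z"
    using z assms dual_scale[OF in_dual[OF z] assms] by (simp add: sym[OF _ z] X_scale)
qed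

lemma diff_left: "x \<in> X \<Longrightarrow> y \<in> X \<Longrightarrow> a (x - y) = a x - a y"
  using add_left[of x "(-1) *\<^sub>R y"] scale_left[of y "-1"] X_scale[of y "-1"] by simp

lemma inject: "inj_on a X"
proof (rule inj_onI)
  fix x y assume xy: "x \<in> X" "y \<in> X" "a x = a y"
  then have "a (x - y) = 0" by (simp add: diff_left)
  then have "a (x - y) (x - y) = 0" by simp
  with xy X_diff definite show "x = y" by force
qed

lemma orthogonal_independent:
  assumes E: "E \<subseteq> X - {0}" and orth: "\<And>x y. x \<in> E \<Longrightarrow> y \<in> E \<Longrightarrow> x \<noteq> y \<Longrightarrow> a x y = 0"
  shows "independent E"
  unfolding dependent_explicit
proof clarify
  fix S u v
  assume S: "finite S" "S \<subseteq> E" and v: "v \<in> S" "u v \<noteq> 0" and 0: "(\<Sum>v\<in>S. u v *\<^sub>R v) = 0"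
  have vX: "v \<in> X" "v \<noteq> 0" using E S v by auto
  have SX: "S \<subseteq> X" using E S by auto
  have "0 = a v (\<Sum>w\<in>S. u w *\<^sub>R w)"
    unfolding 0 by (rule dual_zero[OF subspace in_dual[OF vX(1)], symmetric])
  also have "\<dots> = (\<Sum>w\<in>S. u w * a v w)"
    by (rule dual_lincomb[OF subspace in_dual[OF vX(1)] SX])
  also have "\<dots> = (\<Sum>w\<in>S. if w = v then u v * a v v else 0)"
    using S v orth by (intro sum.cong) auto
  also have "\<dots> = u v * a v v" using S v by simp
  finally show False using v vX definite by auto
qed

text \<open>
  A maximal orthogonal system \<open>E\<close> exists because orthogonal systems are independent and therefore
  bounded in size.  By maximality every \<open>x\<close> equals its Fourier expansion in \<open>E\<close>, as the difference
  could otherwise be added to \<open>E\<close>; a functional is then represented by the element whose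
  coefficients are its values on \<open>E\<close>, normalized.
\<close>

lemma riesz:
  assumes g: "g \<in> dual X"
  obtains x where "x \<in> X" "a x = g"
proof -
  define P where "P E \<longleftrightarrow> E \<subseteq> X - {0} \<and> (\<forall>x\<in>E. \<forall>y\<in>E. x \<noteq> y \<longrightarrow> a x y = 0)" for E
  obtain G where G: "finite G" "X \<subseteq> span G" using finite_dim by (auto simp: finite_dimensional_def)
  have fin: "finite E \<and> card E \<le> card G" if "P E" for E
  proof (rule independent_span_bound[OF G(1)])
    show "independent E" using that unfolding P_def by (intro orthogonal_independent) blast+
    show "E \<subseteq> span G" using that G(2) unfolding P_def by blast
  qed
  have "P {}" by (simp add: P_def)
  moreover have "\<forall>E. P E \<longrightarrow> card E < card G + 1"
  proof (intro allI impI)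
    fix E assume "P E" from fin[OF this] show "card E < card G + 1" by simp
  qed
  ultimately have "\<exists>E. P E \<and> (\<forall>E'. P E' \<longrightarrow> card E' \<le> card E)"
    by (rule Lattices_Big.ex_has_greatest_nat)
  then obtain E where PE: "P E" and max: "\<And>E'. P E' \<Longrightarrow> card E' \<le> card E" by blast
  note E = PE[unfolded P_def]
  have finE: "finite E" using fin[OF PE] by simp
  have EX: "E \<subseteq> X" and E0: "\<And>e. e \<in> E \<Longrightarrow> a e e \<noteq> 0" using E definite by blast+
  \<comment> \<open>otherwise the residual of the expansion would enlarge \<open>E\<close>\<close>
  have expand: "x = (\<Sum>e\<in>E. (a x e / a e e) *\<^sub>R e)" if x: "x \<in> X" for x
  proof (rule ccontr)
    let ?s = "\<Sum>e\<in>E. (a x e / a e e) *\<^sub>R e"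
    assume ne: "x \<noteq> ?s"
    have sX: "?s \<in> X"
      by (rule subspace_sum[OF subspace]) (use EX in \<open>blast intro: X_scale\<close>)
    have orth: "a d (x - ?s) = 0" if d: "d \<in> E" for d
    proof -
      have dX: "d \<in> X" using d EX by auto
      have "a d ?s = (\<Sum>e\<in>E. a x e / a e e * a d e)"
        by (rule dual_lincomb[OF subspace in_dual[OF dX] EX])
      also have "\<dots> = (\<Sum>e\<in>E. if e = d then a x d else 0)"
        using E E0 d by (intro sum.cong) auto
      also have "\<dots> = a d x" using finE d sym[OF dX x] by simp
      finally have "a d ?s = a d x" .
      then show ?thesis by (simp only: dual_diff[OF subspace in_dual[OF dX] x sX] diff_self)
    qed
    define z where "z = x - ?s"
    have z: "z \<in> X" unfolding z_def by (rule X_diff[OF x sX])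
    have z0: "z \<noteq> 0" unfolding z_def right_minus_eq by (rule ne)
    have zE: "a d z = 0" if "d \<in> E" for d unfolding z_def by (rule orth[OF that])
    have "a z d = 0" if d: "d \<in> E" for d
      using zE[OF d] sym[OF z subsetD[OF EX d]] by simp
    then have "P (insert z E)" using E z z0 zE unfolding P_def by blast
    moreover have "z \<notin> E" using zE E0 by blast
    ultimately show False using max[of "insert z E"] finE by simp
  qed
  let ?y = "\<Sum>e\<in>E. (g e / a e e) *\<^sub>R e"
  have yX: "?y \<in> X"
    by (rule subspace_sum[OF subspace]) (use EX in \<open>blast intro: X_scale\<close>)
  have "a ?y = g"
  proof (rule dual_eqI[OF in_dual[OF yX] g])
    fix x assume x: "x \<in> X"
    have "a ?y x = a x ?y" by (rule sym[OF yX x])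
    also have "\<dots> = (\<Sum>e\<in>E. g e / a e e * a x e)"
      by (rule dual_lincomb[OF subspace in_dual[OF x] EX])
    also have "\<dots> = (\<Sum>e\<in>E. a x e / a e e * g e)" by (simp add: mult.commute)
    also have "\<dots> = g (\<Sum>e\<in>E. (a x e / a e e) *\<^sub>R e)"
      by (rule dual_lincomb[OF subspace g EX, symmetric])
    also have "\<dots> = g x" using expand[OF x] by (rule arg_cong[OF HOL.sym])
    finally show "a ?y x = g x" .
  qed
  with yX that show thesis by blast
qed

lemma inv_mem: "g \<in> dual X \<Longrightarrow> inv_into X a g \<in> X"
  and inv_eq: "g \<in> dual X \<Longrightarrow> a (inv_into X a g) = g"
  by (metis riesz inv_into_into image_eqI, metis riesz f_inv_into_f image_eqI)

abbreviation nrm where "nrm \<equiv> energy_norm a"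

lemma nrm_nonneg: "x \<in> X \<Longrightarrow> 0 \<le> nrm x"
  by (simp add: energy_norm_def nonneg)

lemma nrm_sq: "x \<in> X \<Longrightarrow> nrm x * nrm x = a x x"
  by (simp add: energy_norm_def nonneg)

lemma cauchy_schwarz:
  assumes x: "x \<in> X" and y: "y \<in> X"
  shows "a x y \<le> nrm x * nrm y"
proof (cases "y = 0")
  case True
  have "a x y = 0" using dual_scale[OF in_dual[OF x] X_0, of 0] True by simp
  with nrm_nonneg x y show ?thesis by simp
next
  case False
  then have p: "0 < a y y" using nonneg definite y by force
  let ?t = "a x y / a y y"
  have tX: "?t *\<^sub>R y \<in> X" by (rule X_scale[OF y])
  define z where "z = x - ?t *\<^sub>R y"
  have zX: "z \<in> X" unfolding z_def by (rule X_diff[OF x tX])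
  \<comment> \<open>\<open>z\<close> is the residual of the projection of \<open>x\<close> onto the line through \<open>y\<close>\<close>
  have expand: "a z w = a x w - ?t * a y w" for w
    unfolding z_def
    by (simp only: diff_left[OF x tX] scale_left[OF y] minus_apply scaleR_fun_apply real_scaleR_def)
  have "0 \<le> a z z" by (rule nonneg[OF zX])
  also have "\<dots> = a x z - ?t * a y z" by (rule expand)
  also have "\<dots> = a z x - ?t * a z y" by (simp only: sym[OF x zX] sym[OF y zX])
  also have "\<dots> = a x x - a x y * a x y / a y y"
    using p sym[OF x y] unfolding expand by (simp add: field_simps)
  finally have "a x y * a x y \<le> a x x * a y y" using p by (simp add: field_simps)
  then have "\<bar>a x y\<bar> \<le> sqrt (a x x * a y y)"
    by (intro real_le_rsqrt) (simp add: power2_eq_square)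
  then show ?thesis by (simp add: energy_norm_def real_sqrt_mult)
qed

lemma nrm_triangle:
  assumes x: "x \<in> X" and y: "y \<in> X"
  shows "nrm (x + y) \<le> nrm x + nrm y"
proof -
  have "a (x + y) (x + y) = a x x + 2 * a x y + a y y"
    using x y sym[OF x y]
    by (simp add: add_left dual_add[OF in_dual[OF x]] dual_add[OF in_dual[OF y]])
  also have "\<dots> \<le> (nrm x + nrm y)\<^sup>2"
    using cauchy_schwarz[OF x y] nrm_sq[OF x] nrm_sq[OF y]
    by (simp add: power2_eq_square algebra_simps)
  finally show ?thesis
    using nrm_nonneg[OF x] nrm_nonneg[OF y] unfolding energy_norm_def[of a "x + y"]
    by (intro real_le_lsqrt) auto
qed

lemma nrm_uminus: "x \<in> X \<Longrightarrow> nrm (- x) = nrm x"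
  using scale_left[of x "-1"] dual_scale[OF in_dual, of x x "-1"] by (simp add: energy_norm_def)

lemma nrm_diff:
  assumes "x \<in> X" "y \<in> X"
  shows "nrm (x - y) \<le> nrm x + nrm y"
  using nrm_triangle[of x "- y"] nrm_uminus[of y] assms X_scale[of y "-1"] by simp

lemma nrm_le:
  assumes "x \<in> X" "a x x \<le> c * nrm x" "0 \<le> c"
  shows "nrm x \<le> c"
proof (cases "nrm x = 0")
  case False
  then have "0 < nrm x" using nrm_nonneg[OF assms(1)] by simp
  moreover have "nrm x * nrm x \<le> c * nrm x" using assms(2) by (simp only: nrm_sq[OF assms(1)])
  ultimately show ?thesis by simp
qed (use assms in simp)

lemma dual_norm_apply: "x \<in> X \<Longrightarrow> dual_norm X a (a x) = nrm x"
  using inject by (simp add: dual_norm_def energy_norm_def)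

lemma dual_norm_eq: "g \<in> dual X \<Longrightarrow> dual_norm X a g = nrm (inv_into X a g)"
  using dual_norm_apply[OF inv_mem, of g] by (simp add: inv_eq)

lemma dual_norm_nonneg: "g \<in> dual X \<Longrightarrow> 0 \<le> dual_norm X a g"
  by (simp add: dual_norm_eq nrm_nonneg inv_mem)

lemma dual_norm_le:
  assumes "g \<in> dual X" "0 \<le> c" "\<And>x. x \<in> X \<Longrightarrow> g x \<le> c * nrm x"
  shows "dual_norm X a g \<le> c"
  using nrm_le[of "inv_into X a g" c] assms inv_mem[of g] inv_eq[of g] dual_norm_eq[of g] by auto

lemma dual_norm_triangle:
  assumes "g \<in> dual X" "g' \<in> dual X"
  shows "dual_norm X a (g + g') \<le> dual_norm X a g + dual_norm X a g'"
  using assms nrm_triangle[of "inv_into X a g" "inv_into X a g'"]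
    dual_norm_apply[OF X_add[of "inv_into X a g" "inv_into X a g'"]]
  by (simp add: add_left inv_mem inv_eq dual_norm_eq)

lemma dual_norm_uminus:
  assumes "g \<in> dual X"
  shows "dual_norm X a (- g) = dual_norm X a g"
  using assms nrm_uminus[of "inv_into X a g"] scale_left[of "inv_into X a g" "-1"]
    dual_norm_apply[OF X_scale[of "inv_into X a g" "-1"]]
  by (simp add: inv_mem inv_eq dual_norm_eq)

end

section \<open>Saddle point systems\<close>

locale saddle_system = mass: spd_form X M
  for X :: "('p \<Rightarrow> 'v::real_vector) set" and M +
  fixes Y :: "('q \<Rightarrow> 'w::real_vector) set"
    and B Bt D
  assumes subspace_Y: "subspace Y"
    and finite_dim_Y: "finite_dimensional Y"
    and B_dual: "v \<in> Y \<Longrightarrow> B v \<in> dual X"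
    and Bt_dual: "\<sigma> \<in> X \<Longrightarrow> Bt \<sigma> \<in> dual Y"
    and Bt_eq: "\<sigma> \<in> X \<Longrightarrow> v \<in> Y \<Longrightarrow> Bt \<sigma> v = B v \<sigma>"
    and D_dual: "v \<in> Y \<Longrightarrow> D v \<in> dual Y"
    and D_sym: "v \<in> Y \<Longrightarrow> w \<in> Y \<Longrightarrow> D v w = D w v"
    and D_nonneg: "v \<in> Y \<Longrightarrow> 0 \<le> D v v"
    and kernel: "v \<in> Y \<Longrightarrow> (\<And>\<sigma>. \<sigma> \<in> X \<Longrightarrow> B v \<sigma> = 0) \<Longrightarrow> D v v = 0 \<Longrightarrow> v = 0"
begin

text \<open>\<open>R = M\<^sup>-\<^sup>1 B\<close>: the first component \<open>\<sigma> = R u\<close> solves the first equation with zero data.\<close>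

definition R where "R v = inv_into X M (B v)"

abbreviation A where "A \<equiv> schur X M B Bt D"
abbreviation L where "L \<equiv> saddle M B Bt D"

lemma R_mem: "v \<in> Y \<Longrightarrow> R v \<in> X"
  and M_R: "v \<in> Y \<Longrightarrow> M (R v) = B v"
  by (simp_all add: R_def B_dual mass.inv_mem mass.inv_eq)

lemma A_eq: "A v = Bt (R v) + D v"
  by (simp add: schur_def R_def fun_eq_iff)

lemma A_apply: "v \<in> Y \<Longrightarrow> w \<in> Y \<Longrightarrow> A v w = M (R v) (R w) + D v w"
  by (simp add: A_eq Bt_eq R_mem M_R[symmetric] mass.sym[of "R v"])

sublocale stiff: spd_form Y A
proof
  show "A v \<in> dual Y" if "v \<in> Y" for v
    unfolding A_eq
    by (intro subspace_add[OF subspace_dual[OF subspace_Y]] Bt_dual D_dual R_mem that)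
  show "A v w = A w v" if "v \<in> Y" "w \<in> Y" for v w
    unfolding A_apply[OF that] A_apply[OF that(2,1)]
    by (simp only: mass.sym[OF R_mem R_mem, OF that] D_sym[OF that])
  fix v assume v: "v \<in> Y"
  show "0 \<le> A v v" using v by (simp add: A_apply mass.nonneg R_mem D_nonneg)
  assume "A v v = 0"
  then have "M (R v) (R v) = 0" and D0: "D v v = 0"
    using v mass.nonneg[OF R_mem[OF v]] D_nonneg[OF v] by (simp_all add: A_apply)
  then have "R v = 0" using mass.definite R_mem v by blast
  then have "B v = 0" using M_R[OF v] mass.scale_left[OF mass.X_0, of 0] by simp
  then show "v = 0" by (intro kernel[OF v _ D0]) simp
qed (fact subspace_Y finite_dim_Y)+

text \<open>The form of \<open>A\<close> is that of \<open>M\<close> at \<open>R v\<close> plus a nonnegative term.\<close>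

lemma R_le:
  assumes v: "v \<in> Y"
  shows "mass.nrm (R v) \<le> stiff.nrm v"
  using v D_nonneg[OF v] by (simp add: energy_norm_def A_apply)

text \<open>
  Duality turns the bound on \<open>R\<close> into one on \<open>B\<^sup>T\<close>, since \<open>B\<^sup>T \<sigma>\<close> maps \<open>v\<close> to the \<open>M\<close>-product
  of \<open>\<sigma>\<close> and \<open>R v\<close>.
\<close>

lemma Bt_le:
  assumes \<sigma>: "\<sigma> \<in> X"
  shows "dual_norm Y A (Bt \<sigma>) \<le> mass.nrm \<sigma>"
proof (rule stiff.dual_norm_le[OF Bt_dual[OF \<sigma>] mass.nrm_nonneg[OF \<sigma>]])
  fix v assume v: "v \<in> Y"
  have "Bt \<sigma> v = M \<sigma> (R v)" using \<sigma> v by (simp add: Bt_eq M_R[symmetric] mass.sym R_mem)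
  also have "\<dots> \<le> mass.nrm \<sigma> * mass.nrm (R v)" by (rule mass.cauchy_schwarz[OF \<sigma> R_mem[OF v]])
  also have "\<dots> \<le> mass.nrm \<sigma> * stiff.nrm v"
    by (rule mult_left_mono[OF R_le[OF v] mass.nrm_nonneg[OF \<sigma>]])
  finally show "Bt \<sigma> v \<le> mass.nrm \<sigma> * stiff.nrm v" .
qed

lemma Bt_diff:
  assumes "\<sigma> \<in> X" "\<tau> \<in> X"
  shows "Bt (\<sigma> - \<tau>) = Bt \<sigma> - Bt \<tau>"
proof (rule dual_eqI)
  show "Bt (\<sigma> - \<tau>) \<in> dual Y" by (intro Bt_dual mass.X_diff assms)
  show "Bt \<sigma> - Bt \<tau> \<in> dual Y"
    by (intro subspace_diff[OF subspace_dual[OF subspace_Y]] Bt_dual assms)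
  fix v assume v: "v \<in> Y"
  show "Bt (\<sigma> - \<tau>) v = (Bt \<sigma> - Bt \<tau>) v"
    using assms v dual_diff[OF mass.subspace B_dual[OF v] assms] by (simp add: Bt_eq mass.X_diff)
qed

text \<open>
  In the variables \<open>(\<sigma> - R u, u)\<close> the system is block triangular with the isometries \<open>-M\<close> and
  \<open>A\<close> on the diagonal; the bijectivity and both bounds below are read off from this form.
\<close>

lemma L_factor:
  assumes "\<sigma> \<in> X" "u \<in> Y"
  shows "L (\<sigma>, u) = (- M (\<sigma> - R u), A u + Bt (\<sigma> - R u))"
proof -
  have "M (\<sigma> - R u) = M \<sigma> - B u" "Bt (\<sigma> - R u) = Bt \<sigma> - Bt (R u)"
    using mass.diff_left[OF assms(1) R_mem] Bt_diff[OF assms(1) R_mem] M_R assms(2) by simp_all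
  then show ?thesis by (simp add: saddle_def A_eq fun_eq_iff)
qed

lemma bij_L: "bij_betw L (X \<times> Y) (dual X \<times> dual Y)"
proof (rule bij_betwI')
  fix p q assume pq: "p \<in> X \<times> Y" "q \<in> X \<times> Y"
  obtain \<sigma> u \<tau> v where p: "p = (\<sigma>, u)" and q: "q = (\<tau>, v)" by fastforce
  have m: "\<sigma> \<in> X" "u \<in> Y" "\<tau> \<in> X" "v \<in> Y" using pq p q by auto
  show "L p = L q \<longleftrightarrow> p = q"
  proof
    assume "L p = L q"
    then have 1: "M (\<sigma> - R u) = M (\<tau> - R v)"
      and 2: "A u + Bt (\<sigma> - R u) = A v + Bt (\<tau> - R v)"
      unfolding p q L_factor[OF m(1,2)] L_factor[OF m(3,4)] prod.inject neg_equal_iff_equal by blast+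
    have 3: "\<sigma> - R u = \<tau> - R v"
      by (rule inj_onD[OF mass.inject, OF 1]) (intro mass.X_diff R_mem m)+
    from 2 have "A u = A v" unfolding 3 add_right_cancel .
    then have "u = v" by (rule inj_onD[OF stiff.inject, OF _ m(2,4)])
    with 3 show "p = q" by (simp add: p q)
  qed simp
next
  fix p assume "p \<in> X \<times> Y"
  then obtain \<sigma> u where p: "p = (\<sigma>, u)" and m: "\<sigma> \<in> X" "u \<in> Y" by fastforce
  then have d: "\<sigma> - R u \<in> X" by (simp add: mass.X_diff R_mem)
  show "L p \<in> dual X \<times> dual Y"
    unfolding p L_factor[OF m]
    using subspace_neg[OF subspace_dual[OF mass.subspace]] mass.in_dual[OF d]
      subspace_add[OF subspace_dual[OF subspace_Y] stiff.in_dual[OF m(2)] Bt_dual[OF d]] by simp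
next
  fix q assume "q \<in> dual X \<times> dual Y"
  then obtain g f where q: "q = (g, f)" and m: "g \<in> dual X" "f \<in> dual Y" by fastforce
  obtain \<rho> where r: "\<rho> \<in> X" "M \<rho> = - g"
    using mass.riesz subspace_neg[OF subspace_dual[OF mass.subspace] m(1)] by blast
  obtain u where u: "u \<in> Y" "A u = f - Bt \<rho>"
    using stiff.riesz subspace_diff[OF subspace_dual[OF subspace_Y] m(2) Bt_dual[OF r(1)]] by blast
  have \<sigma>: "\<rho> + R u \<in> X" by (intro mass.X_add R_mem r u)
  have "q = L (\<rho> + R u, u)"
    unfolding L_factor[OF \<sigma> u(1)] by (simp add: q r(2) u(2))
  with \<sigma> u(1) show "\<exists>p\<in>X \<times> Y. q = L p" by blast
qed

text \<open>
  With \<open>\<rho> = \<sigma> - R u\<close> the image has norm at most \<open>2 \<parallel>\<rho>\<parallel> + \<parallel>u\<parallel>\<close>, where \<open>\<parallel>\<rho>\<parallel> \<le> \<parallel>\<sigma>\<parallel> + \<parallel>u\<parallel>\<close>.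
\<close>

lemma L_bound:
  "op_norm_le (X \<times> Y) (pair_norm (energy_norm M) (energy_norm A))
     (pair_norm (dual_norm X M) (dual_norm Y A)) L 3"
  unfolding op_norm_le_def
proof clarify
  fix \<sigma> u assume m: "\<sigma> \<in> X" "u \<in> Y"
  let ?\<rho> = "\<sigma> - R u"
  have d: "?\<rho> \<in> X" using m by (simp add: mass.X_diff R_mem)
  have "dual_norm X M (- M ?\<rho>) = mass.nrm ?\<rho>"
    by (simp only: mass.dual_norm_uminus[OF mass.in_dual[OF d]] mass.dual_norm_apply[OF d])
  moreover have "dual_norm Y A (A u + Bt ?\<rho>) \<le> stiff.nrm u + mass.nrm ?\<rho>"
    using stiff.dual_norm_triangle[OF stiff.in_dual[OF m(2)] Bt_dual[OF d]] Bt_le[OF d]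
    unfolding stiff.dual_norm_apply[OF m(2)] by linarith
  moreover have "mass.nrm ?\<rho> \<le> mass.nrm \<sigma> + stiff.nrm u"
    using mass.nrm_diff[OF m(1) R_mem[OF m(2)]] R_le[OF m(2)] by linarith
  ultimately show "pair_norm (dual_norm X M) (dual_norm Y A) (L (\<sigma>, u))
      \<le> 3 * pair_norm (energy_norm M) (energy_norm A) (\<sigma>, u)"
    using mass.nrm_nonneg[OF m(1)] stiff.nrm_nonneg[OF m(2)]
    unfolding L_factor[OF m] pair_norm_def prod.case by argo
qed

text \<open>
  For data \<open>(g, f)\<close> the first row gives \<open>\<parallel>\<rho>\<parallel> = \<parallel>g\<parallel>\<close>, the second \<open>\<parallel>u\<parallel> \<le> \<parallel>f\<parallel> + \<parallel>\<rho>\<parallel>\<close>, and finally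
  \<open>\<parallel>\<sigma>\<parallel> \<le> \<parallel>\<rho>\<parallel> + \<parallel>u\<parallel>\<close>.
\<close>

lemma L_inverse_bound:
  "op_norm_le (dual X \<times> dual Y) (pair_norm (dual_norm X M) (dual_norm Y A))
     (pair_norm (energy_norm M) (energy_norm A)) (inv_into (X \<times> Y) L) 3"
  unfolding op_norm_le_def
proof
  fix q assume "q \<in> dual X \<times> dual Y"
  then have "q \<in> L ` (X \<times> Y)" by (simp only: bij_betw_imp_surj_on[OF bij_L])
  then obtain \<sigma> u where q: "q = L (\<sigma>, u)" and m: "\<sigma> \<in> X" "u \<in> Y" by blast
  have inv: "inv_into (X \<times> Y) L q = (\<sigma>, u)"
    unfolding q by (rule inv_into_f_f[OF bij_betw_imp_inj_on[OF bij_L]]) (use m in blast)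
  let ?\<rho> = "\<sigma> - R u"
  have d: "?\<rho> \<in> X" using m by (simp add: mass.X_diff R_mem)
  let ?f = "A u + Bt ?\<rho>"
  have f: "?f \<in> dual Y"
    by (rule subspace_add[OF subspace_dual[OF subspace_Y] stiff.in_dual[OF m(2)] Bt_dual[OF d]])
  have q1: "dual_norm X M (- M ?\<rho>) = mass.nrm ?\<rho>"
    by (simp only: mass.dual_norm_uminus[OF mass.in_dual[OF d]] mass.dual_norm_apply[OF d])
  have "stiff.nrm u = dual_norm Y A (?f + - Bt ?\<rho>)"
    by (simp only: add_uminus_conv_diff add_diff_cancel_right' stiff.dual_norm_apply[OF m(2)])
  also have "\<dots> \<le> dual_norm Y A ?f + mass.nrm ?\<rho>"
    using stiff.dual_norm_triangle[OF f subspace_neg[OF subspace_dual[OF subspace_Y] Bt_dual[OF d]]]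
      stiff.dual_norm_uminus[OF Bt_dual[OF d]] Bt_le[OF d] by linarith
  finally have "stiff.nrm u \<le> dual_norm Y A ?f + mass.nrm ?\<rho>" .
  moreover have "mass.nrm \<sigma> \<le> mass.nrm ?\<rho> + stiff.nrm u"
    using mass.nrm_triangle[OF d R_mem[OF m(2)]] R_le[OF m(2)]
    unfolding diff_add_cancel by linarith
  moreover have "0 \<le> dual_norm Y A ?f" by (rule stiff.dual_norm_nonneg[OF f])
  ultimately show "pair_norm (energy_norm M) (energy_norm A) (inv_into (X \<times> Y) L q)
      \<le> 3 * pair_norm (dual_norm X M) (dual_norm Y A) q"
    unfolding inv unfolding q L_factor[OF m] pair_norm_def prod.case using q1 by argo
qed

end

section \<open>Square integrable functions\<close>

text \<open>The product is dominated by the sum of the two squares.\<close>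

lemma L2_product_integrable:
  assumes "L2 \<Omega> f" "L2 \<Omega> g"
  shows "set_integrable lborel \<Omega> (\<lambda>x. f x \<bullet> g x)"
  unfolding set_integrable_def
proof (rule Bochner_Integration.integrable_bound)
  let ?f = "\<lambda>x. indicator \<Omega> x *\<^sub>R f x" and ?g = "\<lambda>x. indicator \<Omega> x *\<^sub>R g x"
  have [measurable]: "?f \<in> borel_measurable lborel" "?g \<in> borel_measurable lborel"
    using assms by (simp_all add: L2_def set_borel_measurable_def)
  show "integrable lborel (\<lambda>x. indicator \<Omega> x *\<^sub>R (f x \<bullet> f x) + indicator \<Omega> x *\<^sub>R (g x \<bullet> g x))"
    using assms by (intro Bochner_Integration.integrable_add) (simp_all add: L2_def set_integrable_def)
  have eq: "(\<lambda>x. indicator \<Omega> x *\<^sub>R (f x \<bullet> g x)) = (\<lambda>x. ?f x \<bullet> ?g x)"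
    by (auto simp: indicator_def)
  show "(\<lambda>x. indicator \<Omega> x *\<^sub>R (f x \<bullet> g x)) \<in> borel_measurable lborel"
    unfolding eq by measurable
  have "\<bar>f x \<bullet> g x\<bar> \<le> f x \<bullet> f x + g x \<bullet> g x" for x
  proof -
    have "0 \<le> (f x - g x) \<bullet> (f x - g x)" "0 \<le> (f x + g x) \<bullet> (f x + g x)"
      by (rule inner_ge_zero)+
    then have "2 * \<bar>f x \<bullet> g x\<bar> \<le> f x \<bullet> f x + g x \<bullet> g x"
      by (simp add: inner_diff_left inner_diff_right inner_add_left inner_add_right inner_commute)
    then show ?thesis using abs_ge_zero[of "f x \<bullet> g x"] by linarith
  qed
  then show "AE x in lborel. norm (indicator \<Omega> x *\<^sub>R (f x \<bullet> g x))
      \<le> norm (indicator \<Omega> x *\<^sub>R (f x \<bullet> f x) + indicator \<Omega> x *\<^sub>R (g x \<bullet> g x))"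
    by (auto simp: indicator_def intro!: order_trans[OF _ abs_ge_self])
qed

lemma L2_zero: "L2 \<Omega> 0"
  by (simp add: L2_def set_borel_measurable_def set_integrable_def)

lemma L2_add:
  assumes "L2 \<Omega> f" "L2 \<Omega> g"
  shows "L2 \<Omega> (f + g)"
proof -
  have "set_integrable lborel \<Omega> (\<lambda>x. (f x \<bullet> f x + g x \<bullet> g x) + (f x \<bullet> g x + g x \<bullet> f x))"
    using assms by (intro set_integral_add L2_product_integrable)
  then have "set_integrable lborel \<Omega> (\<lambda>x. (f + g) x \<bullet> (f + g) x)"
    by (simp add: inner_add_left inner_add_right algebra_simps)
  moreover have "set_borel_measurable lborel \<Omega> (f + g)"
    using assms by (auto simp: L2_def set_borel_measurable_def scaleR_add_right)
  ultimately show ?thesis by (simp add: L2_def)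
qed

lemma L2_scale:
  assumes "L2 \<Omega> f"
  shows "L2 \<Omega> (c *\<^sub>R f)"
proof -
  have "set_integrable lborel \<Omega> (\<lambda>x. (c * c) *\<^sub>R (f x \<bullet> f x))"
    using assms unfolding L2_def set_integrable_def
    by (subst scaleR_left_commute) (intro integrable_scaleR_right, blast)
  moreover have "(\<lambda>x. c *\<^sub>R (indicator \<Omega> x *\<^sub>R f x)) \<in> borel_measurable lborel"
    using assms unfolding L2_def set_borel_measurable_def
    by (intro borel_measurable_scaleR[OF borel_measurable_const]) blast
  ultimately show ?thesis
    by (simp add: L2_def set_borel_measurable_def mult.assoc mult.left_commute mult.commute)
qed

lemma L2_diff: "L2 \<Omega> f \<Longrightarrow> L2 \<Omega> g \<Longrightarrow> L2 \<Omega> (f - g)"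
  using L2_add[OF _ L2_scale[of \<Omega> g "-1"], of f] by (simp only: scaleR_minus1_left diff_conv_add_uminus)

lemma l2_commute: "l2 \<Omega> f g = l2 \<Omega> g f"
  by (simp add: l2_def inner_commute)

lemma l2_nonneg: "0 \<le> l2 \<Omega> f f"
  unfolding l2_def set_lebesgue_integral_def
  by (rule Bochner_Integration.integral_nonneg) (simp add: indicator_def)

lemma l2_add_right:
  assumes "L2 \<Omega> f" "L2 \<Omega> g" "L2 \<Omega> w"
  shows "l2 \<Omega> w (f + g) = l2 \<Omega> w f + l2 \<Omega> w g"
  using set_integral_add(2)[OF L2_product_integrable[OF assms(3,1)] L2_product_integrable[OF assms(3,2)]]
  by (simp add: l2_def inner_add_right)

lemma l2_scale_right: "l2 \<Omega> w (c *\<^sub>R f) = c * l2 \<Omega> w f"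
proof -
  have "l2 \<Omega> w (c *\<^sub>R f) = (LINT x:\<Omega>|lborel. c * (w x \<bullet> f x))" by (simp add: l2_def)
  also have "\<dots> = c * l2 \<Omega> w f" unfolding l2_def by simp
  finally show ?thesis .
qed

lemma l2_add_left:
  "L2 \<Omega> f \<Longrightarrow> L2 \<Omega> g \<Longrightarrow> L2 \<Omega> w \<Longrightarrow> l2 \<Omega> (f + g) w = l2 \<Omega> f w + l2 \<Omega> g w"
  by (simp only: l2_commute[of \<Omega> _ w] l2_add_right)

lemma l2_scale_left: "l2 \<Omega> (c *\<^sub>R f) w = c * l2 \<Omega> f w"
  by (simp only: l2_commute[of \<Omega> _ w] l2_scale_right)

lemma l2_parallelogram_le:
  assumes f: "L2 \<Omega> f" and g: "L2 \<Omega> g"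
  shows "l2 \<Omega> (f + g) (f + g) \<le> 2 * l2 \<Omega> f f + 2 * l2 \<Omega> g g"
proof -
  have square: "l2 \<Omega> (f + w) (f + w) = l2 \<Omega> f f + 2 * l2 \<Omega> f w + l2 \<Omega> w w" if w: "L2 \<Omega> w" for w
    using l2_add_left[OF f w L2_add[OF f w]] l2_add_right[OF f w f] l2_add_right[OF f w w]
      l2_commute[of \<Omega> w f] by simp
  have "0 \<le> l2 \<Omega> (f + (-1) *\<^sub>R g) (f + (-1) *\<^sub>R g)" by (rule l2_nonneg)
  also have "\<dots> = l2 \<Omega> f f - 2 * l2 \<Omega> f g + l2 \<Omega> g g"
    unfolding square[OF L2_scale[OF g]] l2_scale_left l2_scale_right by simp
  finally show ?thesis unfolding square[OF g] by simp
qed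

lemma L2_tendsto_iff:
  "L2_tendsto \<Omega> f u \<longleftrightarrow>
     L2 \<Omega> u \<and> (\<forall>n. L2 \<Omega> (f n)) \<and> (\<lambda>n. l2 \<Omega> (f n - u) (f n - u)) \<longlonglongrightarrow> 0"
  by (simp only: L2_tendsto_def fun_diff_def)

lemma L2_tendsto_add:
  assumes "L2_tendsto \<Omega> f u" "L2_tendsto \<Omega> g v"
  shows "L2_tendsto \<Omega> (\<lambda>n. f n + g n) (u + v)"
proof -
  have L: "L2 \<Omega> u" "L2 \<Omega> v" "\<And>n. L2 \<Omega> (f n)" "\<And>n. L2 \<Omega> (g n)"
    and lim: "(\<lambda>n. l2 \<Omega> (f n - u) (f n - u)) \<longlonglongrightarrow> 0" "(\<lambda>n. l2 \<Omega> (g n - v) (g n - v)) \<longlonglongrightarrow> 0"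
    using assms unfolding L2_tendsto_iff by blast+
  have d: "L2 \<Omega> (f n - u)" "L2 \<Omega> (g n - v)" for n
    using L by (simp_all only: L2_diff)
  define e where "e n = 2 * l2 \<Omega> (f n - u) (f n - u) + 2 * l2 \<Omega> (g n - v) (g n - v)" for n
  have "e \<longlonglongrightarrow> 2 * 0 + 2 * 0" unfolding e_def by (intro tendsto_intros lim)
  then have "e \<longlonglongrightarrow> 0" by simp
  moreover have "l2 \<Omega> (f n + g n - (u + v)) (f n + g n - (u + v)) \<le> e n" for n
    unfolding e_def add_diff_add by (rule l2_parallelogram_le[OF d])
  ultimately have "(\<lambda>n. l2 \<Omega> (f n + g n - (u + v)) (f n + g n - (u + v))) \<longlonglongrightarrow> 0"
    by (rule tendsto_sandwich[OF always_eventually[OF allI[OF l2_nonneg]] always_eventually[OF allI]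
          tendsto_const, rotated])
  with L show ?thesis unfolding L2_tendsto_iff by (blast intro: L2_add)
qed

lemma L2_tendsto_scale:
  assumes "L2_tendsto \<Omega> f u"
  shows "L2_tendsto \<Omega> (\<lambda>n. c *\<^sub>R f n) (c *\<^sub>R u)"
proof -
  have lim: "(\<lambda>n. l2 \<Omega> (f n - u) (f n - u)) \<longlonglongrightarrow> 0"
    using assms unfolding L2_tendsto_iff by blast
  have "l2 \<Omega> (c *\<^sub>R f n - c *\<^sub>R u) (c *\<^sub>R f n - c *\<^sub>R u) = c * (c * l2 \<Omega> (f n - u) (f n - u))" for n
    by (simp only: scaleR_diff_right[symmetric] l2_scale_left l2_scale_right)
  then have "(\<lambda>n. l2 \<Omega> (c *\<^sub>R f n - c *\<^sub>R u) (c *\<^sub>R f n - c *\<^sub>R u)) \<longlonglongrightarrow> c * (c * 0)"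
    by (simp only:) (intro tendsto_intros lim)
  with assms show ?thesis unfolding L2_tendsto_iff mult_zero_right by (blast intro: L2_scale)
qed

lemma L2_tendsto_zero: "L2_tendsto \<Omega> (\<lambda>n. 0) 0"
  by (simp add: L2_tendsto_def L2_zero l2_def)

section \<open>Spaces of shape functions\<close>

lemma finite_dimensional_mono: "finite_dimensional Y \<Longrightarrow> X \<subseteq> Y \<Longrightarrow> finite_dimensional X"
  unfolding finite_dimensional_def by blast

lemma finite_dimensional_image:
  assumes "linear F" "finite_dimensional X"
  shows "finite_dimensional (F ` X)"
proof -
  obtain G where G: "finite G" "X \<subseteq> span G" using assms(2) by (auto simp: finite_dimensional_def)
  have "F ` X \<subseteq> span (F ` G)" using G(2) linear_span_image[OF assms(1), of G] by blast
  with G(1) show ?thesis unfolding finite_dimensional_def by blast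
qed

lemma finite_dimensional_sum:
  assumes I: "finite I" and X: "\<And>i. i \<in> I \<Longrightarrow> finite_dimensional (X i)"
    and dec: "\<And>u. u \<in> Y \<Longrightarrow> \<exists>f. (\<forall>i\<in>I. f i \<in> X i) \<and> u = sum f I"
  shows "finite_dimensional Y"
proof -
  obtain G where G: "\<And>i. i \<in> I \<Longrightarrow> finite (G i) \<and> X i \<subseteq> span (G i)"
    using X unfolding finite_dimensional_def by metis
  have "u \<in> span (\<Union>i\<in>I. G i)" if u: "u \<in> Y" for u
  proof -
    obtain f where f: "\<And>i. i \<in> I \<Longrightarrow> f i \<in> X i" "u = sum f I" using dec[OF u] by blast
    have "f i \<in> span (\<Union>i\<in>I. G i)" if "i \<in> I" for i
      using f(1)[OF that] G[OF that] span_mono[of "G i" "\<Union>i\<in>I. G i"] that by blast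
    then show ?thesis unfolding f(2) by (rule span_sum)
  qed
  moreover have "finite (\<Union>i\<in>I. G i)" using I G by blast
  ultimately show ?thesis unfolding finite_dimensional_def by blast
qed

lemma sum_fun_apply: "sum f I x = (\<Sum>i\<in>I. f i x)"
  by (induction I rule: infinite_finite_induct) simp_all

text \<open>
  The properties of a space of polynomials on a single cell that the construction of the global
  space depends on.
\<close>

definition shape_space :: "(real^3 \<Rightarrow> 'v::euclidean_space) set \<Rightarrow> bool" where
  "shape_space P \<longleftrightarrow>
     subspace P \<and> finite_dimensional P \<and> (\<forall>p\<in>P. \<forall>x. p differentiable (at x))"

lemma shape_space_polys: "shape_space (polys k)"
proof -
  define m :: "nat \<times> nat \<times> nat \<Rightarrow> real^3 \<Rightarrow> real"
    where "m = (\<lambda>(i, j, l) x. (x$1)^i * (x$2)^j * (x$3)^l)"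
  define I where "I = (SIGMA i:{..k}. SIGMA j:{..k - i}. {..k - i - j})"
  have finI: "finite I" by (simp add: I_def)
  have m_diff: "m t differentiable (at x)" for t x
    by (cases t) (auto simp: m_def intro!: differentiable_mult differentiable_power
      bounded_linear_imp_differentiable[OF bounded_linear_vec_nth])
  have rep: "p \<in> polys k \<longleftrightarrow> (\<exists>c. p = (\<Sum>t\<in>I. c t *\<^sub>R m t))" for p
  proof
    assume "p \<in> polys k"
    then obtain c where "\<forall>x. p x = (\<Sum>i\<le>k. \<Sum>j\<le>k - i. \<Sum>l\<le>k - i - j. c i j l * (x$1)^i * (x$2)^j * (x$3)^l)"
      by (auto simp: polys_def)
    then have "p x = (\<Sum>t\<in>I. (\<lambda>(i, j, l). c i j l) t *\<^sub>R m t) x" for x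
      by (simp add: sum_fun_apply I_def m_def sum.Sigma split_def mult.assoc)
    then show "\<exists>c. p = (\<Sum>t\<in>I. c t *\<^sub>R m t)" by blast
  next
    assume "\<exists>c. p = (\<Sum>t\<in>I. c t *\<^sub>R m t)"
    then obtain c where c: "p = (\<Sum>t\<in>I. c t *\<^sub>R m t)" by blast
    have "p x = (\<Sum>i\<le>k. \<Sum>j\<le>k - i. \<Sum>l\<le>k - i - j. c (i, j, l) * (x$1)^i * (x$2)^j * (x$3)^l)" for x
      by (simp add: c sum_fun_apply I_def m_def sum.Sigma split_def mult.assoc)
    then show "p \<in> polys k" unfolding polys_def by (auto intro!: exI[of _ "\<lambda>i j l. c (i, j, l)"])
  qed
  have "subspace (polys k)"
  proof (rule subspaceI)
    show "0 \<in> polys k" unfolding rep by (rule exI[of _ "\<lambda>_. 0"]) simp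
  next
    fix p q assume "p \<in> polys k" "q \<in> polys k"
    then obtain c d where "p = (\<Sum>t\<in>I. c t *\<^sub>R m t)" "q = (\<Sum>t\<in>I. d t *\<^sub>R m t)" unfolding rep by blast
    then have "p + q = (\<Sum>t\<in>I. (c t + d t) *\<^sub>R m t)"
      by (simp only: scaleR_add_left sum.distrib)
    then show "p + q \<in> polys k" unfolding rep by (rule exI[of _ "\<lambda>t. c t + d t"])
  next
    fix a :: real and p assume "p \<in> polys k"
    then obtain c where "p = (\<Sum>t\<in>I. c t *\<^sub>R m t)" unfolding rep by blast
    then have "a *\<^sub>R p = (\<Sum>t\<in>I. (a * c t) *\<^sub>R m t)"
      by (simp only: scaleR_sum_right scaleR_scaleR)
    then show "a *\<^sub>R p \<in> polys k" unfolding rep by (rule exI[of _ "\<lambda>t. a * c t"])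
  qed
  moreover have "finite_dimensional (polys k)"
    unfolding finite_dimensional_def
  proof (intro exI conjI subsetI)
    show "finite (m ` I)" using finI by simp
    fix p assume "p \<in> polys k"
    then obtain c where c: "p = (\<Sum>t\<in>I. c t *\<^sub>R m t)" unfolding rep by blast
    show "p \<in> span (m ` I)" unfolding c by (intro span_sum span_scale span_base imageI)
  qed
  moreover have "p differentiable (at x)" if p: "p \<in> polys k" for p x
  proof -
    obtain c where c: "p = (\<Sum>t\<in>I. c t *\<^sub>R m t)" using p unfolding rep by blast
    have "p = (\<lambda>x. \<Sum>t\<in>I. c t *\<^sub>R m t x)" by (simp add: c fun_eq_iff sum_fun_apply)
    then show ?thesis using finI m_diff by (auto intro!: differentiable_sum differentiable_scaleR)
  qed
  ultimately show ?thesis by (simp add: shape_space_def)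
qed

text \<open>
  Covers the first-kind edge elements, with \<open>F b\<close> the field \<open>x \<mapsto> x \<times> b x\<close>, and the
  Raviart-Thomas elements, with \<open>F q\<close> the field \<open>x \<mapsto> q x x\<close>.
\<close>

lemma shape_space_combine:
  fixes F :: "(real^3 \<Rightarrow> 'u::euclidean_space) \<Rightarrow> real^3 \<Rightarrow> 'v::euclidean_space"
  assumes A: "shape_space A" and B: "shape_space B" and F: "linear F"
    and F_diff: "\<And>b x. b differentiable (at x) \<Longrightarrow> F b differentiable (at x)"
  shows "shape_space {p. \<exists>a\<in>A. \<exists>b\<in>B. \<forall>x. p x = a x + F b x}" (is "shape_space ?P")
proof -
  have P: "p \<in> ?P \<longleftrightarrow> (\<exists>a\<in>A. \<exists>b\<in>B. p = a + F b)" for p by (simp add: fun_eq_iff)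
  have sub: "subspace A" "subspace B" using A B by (simp_all add: shape_space_def)
  have "subspace ?P"
  proof (rule subspaceI)
    show "0 \<in> ?P" unfolding P
      by (rule bexI[of _ 0], rule bexI[of _ 0])
        (simp_all only: linear_0[OF F] add_0 subspace_0 sub)
  next
    fix p q assume "p \<in> ?P" "q \<in> ?P"
    then obtain a b a' b' where m: "a \<in> A" "b \<in> B" "a' \<in> A" "b' \<in> B"
      and pq: "p = a + F b" "q = a' + F b'" unfolding P by blast
    show "p + q \<in> ?P" unfolding P
    proof (intro bexI)
      show "p + q = (a + a') + F (b + b')" by (simp only: pq linear_add[OF F] add_ac)
    qed (intro subspace_add sub m)+
  next
    fix c :: real and p assume "p \<in> ?P"
    then obtain a b where m: "a \<in> A" "b \<in> B" and p: "p = a + F b" unfolding P by blast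
    show "c *\<^sub>R p \<in> ?P" unfolding P
    proof (intro bexI)
      show "c *\<^sub>R p = c *\<^sub>R a + F (c *\<^sub>R b)" by (simp only: p linear_scale[OF F] scaleR_add_right)
    qed (intro subspace_scale sub m)+
  qed
  moreover have "finite_dimensional ?P"
  proof (rule finite_dimensional_sum)
    fix i :: bool
    show "finite_dimensional (if i then A else F ` B)"
      using A B finite_dimensional_image[OF F] by (simp add: shape_space_def)
  next
    fix p assume "p \<in> ?P"
    then obtain a b where m: "a \<in> A" "b \<in> B" and p: "p = a + F b" unfolding P by blast
    show "\<exists>f. (\<forall>i\<in>UNIV. f i \<in> (if i then A else F ` B)) \<and> p = sum f UNIV"
      by (rule exI[of _ "\<lambda>i. if i then a else F b"]) (use m in \<open>simp add: UNIV_bool p add.commute\<close>)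
  qed simp
  moreover have "p differentiable (at x)" if p: "p \<in> ?P" for p x
  proof -
    obtain a b where m: "a \<in> A" "b \<in> B" and p: "p = (\<lambda>x. a x + F b x)"
      using p unfolding P plus_fun_def by blast
    show ?thesis unfolding p
      using m A B F_diff by (intro differentiable_add) (auto simp: shape_space_def)
  qed
  ultimately show ?thesis by (simp add: shape_space_def)
qed

lemma differentiable_component:
  "u differentiable (at x) \<Longrightarrow> (\<lambda>y. u y $ i) differentiable (at x)"
  for u :: "real^3 \<Rightarrow> real^3"
  unfolding differentiable_def
  using bounded_linear.has_derivative[OF bounded_linear_vec_nth] by blast

lemma differentiable_vecI:
  fixes u :: "real^3 \<Rightarrow> real^3"
  assumes "\<And>i. (\<lambda>y. u y $ i) differentiable (at x)"
  shows "u differentiable (at x)"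
  unfolding differentiable_componentwise_within[of u x UNIV]
  using assms by (auto simp: Basis_vec_def inner_axis)

lemma shape_space_vpolys: "shape_space (vpolys k)"
proof -
  note P = shape_space_polys[of k, unfolded shape_space_def]
  have "subspace (vpolys k)"
  proof (rule subspaceI)
    show "0 \<in> vpolys k"
      using subspace_0[OF P[THEN conjunct1]] by (simp add: vpolys_def zero_fun_def)
  next
    fix p q assume "p \<in> vpolys k" "q \<in> vpolys k"
    then show "p + q \<in> vpolys k"
      using subspace_add[OF P[THEN conjunct1]] by (auto simp: vpolys_def plus_fun_def)
  next
    fix c :: real and p assume "p \<in> vpolys k"
    then show "c *\<^sub>R p \<in> vpolys k"
      using subspace_scale[OF P[THEN conjunct1]] by (auto simp: vpolys_def scaleR_fun_def)
  qed
  moreover have "finite_dimensional (vpolys k)"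
  proof (rule finite_dimensional_sum)
    fix i :: 3
    let ?F = "\<lambda>p (x::real^3). p x *\<^sub>R (axis i 1 :: real^3)"
    have "linear ?F" by (rule linearI) (simp_all add: fun_eq_iff scaleR_add_left)
    then show "finite_dimensional (?F ` polys k)" using P finite_dimensional_image by blast
  next
    fix p assume p: "p \<in> vpolys k"
    have "p x = (\<Sum>i\<in>UNIV. p x $ i *\<^sub>R axis i 1)" for x
      by (simp add: vec_eq_iff axis_def if_distrib[of "\<lambda>t. _ * t"] cong: if_cong)
    then have "p = (\<Sum>i\<in>UNIV. (\<lambda>x. p x $ i *\<^sub>R axis i 1))" by (simp add: fun_eq_iff sum_fun_apply)
    with p show "\<exists>f. (\<forall>i\<in>UNIV. f i \<in> (\<lambda>p (x::real^3). p x *\<^sub>R (axis i 1 :: real^3)) ` polys k) \<and> p = sum f UNIV"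
      by (intro exI[of _ "\<lambda>i x. p x $ i *\<^sub>R axis i 1"]) (auto simp: vpolys_def)
  qed simp
  moreover have "p differentiable (at x)" if "p \<in> vpolys k" for p x
    using that P by (intro differentiable_vecI) (auto simp: vpolys_def)
  ultimately show ?thesis by (simp add: shape_space_def)
qed

lemma shape_space_edge: "shape_space (edge_polys e)"
proof (cases e)
  case (Nedelec_first k)
  have "linear (\<lambda>b x. cross3 x (b x))"
    by (rule linearI) (simp_all add: fun_eq_iff cross_add_right cross_mult_right)
  moreover have "(\<lambda>x. cross3 x (b x)) differentiable (at x)" if b: "b differentiable (at x)" for b x
  proof -
    obtain D where "(b has_derivative D) (at x)" using b by (auto simp: differentiable_def)
    from bounded_bilinear.FDERIV[OF bilinear_conv_bounded_bilinear[THEN iffD1, OF bilinear_cross]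
        has_derivative_ident this]
    show ?thesis by (auto simp: differentiable_def)
  qed
  ultimately show ?thesis
    unfolding Nedelec_first edge_polys.simps by (intro shape_space_combine shape_space_vpolys)
qed (simp add: shape_space_vpolys)

lemma shape_space_face: "shape_space (face_polys f)"
proof (cases f)
  case (Raviart_Thomas k)
  have "linear (\<lambda>q x. q x *\<^sub>R x)"
    by (rule linearI) (simp_all add: fun_eq_iff scaleR_add_left)
  moreover have "(\<lambda>x. q x *\<^sub>R x) differentiable (at x)" if "q differentiable (at x)" for q x
    using that by (intro differentiable_scaleR) auto
  ultimately show ?thesis
    unfolding Raviart_Thomas face_polys.simps
    by (intro shape_space_combine shape_space_vpolys shape_space_polys)
qed (simp add: shape_space_vpolys)

section \<open>Piecewise functions on a mesh\<close>

text \<open>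
  The intersection of two cells is a face of each; a face that meets the interior is the whole cell.
\<close>

lemma cells_disjoint:
  assumes "triangulation T" "K \<in> T" "K' \<in> T" "x \<in> interior K" "x \<in> interior K'"
  shows "K = K'"
proof -
  have f: "K \<inter> K' face_of K" "K' \<inter> K face_of K'"
    using assms(1-3) unfolding triangulation_def by blast+
  have x: "x \<in> K" "x \<in> K'" using assms(4,5) interior_subset by blast+
  have "K \<inter> K' = K" using face_of_disjoint_interior[OF f(1)] assms(4) x by blast
  moreover have "K' \<inter> K = K'" using face_of_disjoint_interior[OF f(2)] assms(5) x by blast
  ultimately show ?thesis by blast
qed

lemma open_open_cells: "open (open_cells T)"
  unfolding open_cells_def by blast

lemma open_cells_subset:
  assumes "convex_polyhedral_domain \<Omega>" "mesh_of \<Omega> T"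
  shows "open_cells T \<subseteq> \<Omega>"
proof -
  have "open_cells T \<subseteq> interior (closure \<Omega>)"
    unfolding open_cells_def using assms(2) by (intro UN_least interior_mono) (auto simp: mesh_of_def)
  also have "\<dots> = \<Omega>"
    using assms(1) convex_interior_closure[of \<Omega>] by (simp add: convex_polyhedral_domain_def interior_open)
  finally show ?thesis .
qed

lemma subspace_piecewise:
  assumes "subspace P"
  shows "subspace (piecewise T P)"
proof (rule subspaceI)
  show "0 \<in> piecewise T P"
    using subspace_0[OF assms] by (auto simp: piecewise_def intro!: bexI[of _ 0])
next
  fix u v assume uv: "u \<in> piecewise T P" "v \<in> piecewise T P"
  have "\<exists>p\<in>P. \<forall>x\<in>interior K. (u + v) x = p x" if K: "K \<in> T" for K
  proof -
    obtain p q where "p \<in> P" "q \<in> P" "\<forall>x\<in>interior K. u x = p x" "\<forall>x\<in>interior K. v x = q x"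
      using uv K unfolding piecewise_def by blast
    then show ?thesis using subspace_add[OF assms] by (intro bexI[of _ "p + q"]) simp_all
  qed
  then show "u + v \<in> piecewise T P" using uv by (simp add: piecewise_def)
next
  fix c :: real and u assume u: "u \<in> piecewise T P"
  have "\<exists>p\<in>P. \<forall>x\<in>interior K. (c *\<^sub>R u) x = p x" if K: "K \<in> T" for K
  proof -
    obtain p where "p \<in> P" "\<forall>x\<in>interior K. u x = p x"
      using u K by (auto simp: piecewise_def)
    then show ?thesis using subspace_scale[OF assms] by (intro bexI[of _ "c *\<^sub>R p"]) simp_all
  qed
  then show "c *\<^sub>R u \<in> piecewise T P" using u by (simp add: piecewise_def)
qed

text \<open>
  As the open cells are disjoint, a piecewise function is the sum over the cells of its pieces
  extended by zero.
\<close>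

lemma finite_dimensional_piecewise:
  assumes T: "triangulation T" and P: "finite_dimensional P"
  shows "finite_dimensional (piecewise T (P :: (real^3 \<Rightarrow> 'a::real_vector) set))"
proof (rule finite_dimensional_sum)
  show finT: "finite T" using T by (simp add: triangulation_def)
  let ?F = "\<lambda>K p (x::real^3). if x \<in> interior K then p x else (0::'a)"
  fix K
  have "linear (?F K)" by (rule linearI) (simp_all add: fun_eq_iff)
  then show "finite_dimensional (?F K ` P)" using P by (rule finite_dimensional_image)
next
  have finT: "finite T" using T by (simp add: triangulation_def)
  let ?F = "\<lambda>K p (x::real^3). if x \<in> interior K then p x else (0::'a)"
  fix u assume u: "u \<in> piecewise T P"
  then have "\<forall>K\<in>T. \<exists>q. q \<in> P \<and> (\<forall>x\<in>interior K. u x = q x)" unfolding piecewise_def by blast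
  from bchoice[OF this] obtain p
    where p: "\<And>K. K \<in> T \<Longrightarrow> p K \<in> P" "\<And>K x. K \<in> T \<Longrightarrow> x \<in> interior K \<Longrightarrow> u x = p K x" by blast
  have "u x = (\<Sum>K\<in>T. ?F K (p K) x)" for x
  proof (cases "x \<in> open_cells T")
    case True
    then obtain K where K: "K \<in> T" "x \<in> interior K" by (auto simp: open_cells_def)
    have "(\<Sum>K'\<in>T. ?F K' (p K') x) = (\<Sum>K'\<in>T. if K' = K then u x else 0)"
    proof (rule sum.cong[OF refl])
      fix K' assume K': "K' \<in> T"
      have "x \<in> interior K' \<longleftrightarrow> K' = K" using cells_disjoint[OF T K' K(1) _ K(2)] K(2) by blast
      then show "?F K' (p K') x = (if K' = K then u x else 0)" using p(2)[OF K] by simp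
    qed
    with K finT show ?thesis by simp
  next
    case False
    then have "x \<notin> interior K" if "K \<in> T" for K using that by (auto simp: open_cells_def)
    then have "(\<Sum>K\<in>T. ?F K (p K) x) = 0" by (intro sum.neutral) auto
    with False u show ?thesis by (simp add: piecewise_def)
  qed
  then have "u = (\<Sum>K\<in>T. ?F K (p K))" by (intro ext) (simp only: sum_fun_apply)
  moreover have "\<forall>K\<in>T. ?F K (p K) \<in> ?F K ` P" using p(1) by blast
  ultimately show "\<exists>f. (\<forall>K\<in>T. f K \<in> ?F K ` P) \<and> u = sum f T"
    by (intro exI[of _ "\<lambda>K. ?F K (p K)"] conjI)
qed

lemma piecewise_differentiable:
  assumes P: "shape_space P" and u: "u \<in> piecewise T P" and x: "x \<in> open_cells T"
  shows "u differentiable (at x)"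
proof -
  obtain K where K: "K \<in> T" "x \<in> interior K" using x by (auto simp: open_cells_def)
  obtain p where p: "p \<in> P" "\<And>y. y \<in> interior K \<Longrightarrow> u y = p y"
    using u K by (auto simp: piecewise_def)
  have "p differentiable (at x)" using P p by (simp add: shape_space_def)
  then obtain D where D: "(p has_derivative D) (at x)" by (auto simp: differentiable_def)
  have "(u has_derivative D) (at x)"
    by (rule has_derivative_transform_within_open[OF D open_interior K(2)]) (simp add: p)
  then show ?thesis by (auto simp: differentiable_def)
qed

text \<open>
  The points of the open cells where \<open>u\<close> does not vanish form an open null set, hence the empty set.
\<close>

lemma piecewise_definite:
  assumes P: "shape_space P" and u: "u \<in> piecewise T P" and sub: "open_cells T \<subseteq> \<Omega>"
    and L: "L2 \<Omega> u" and 0: "l2 \<Omega> u u = 0"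
  shows "u = 0"
proof -
  define N where "N = open_cells T \<inter> u -` (- {0})"
  have "continuous_on (open_cells T) u"
    using piecewise_differentiable[OF P u] differentiable_imp_continuous_within
    by (intro continuous_at_imp_continuous_on) blast
  then have N: "open N"
    unfolding N_def by (intro continuous_open_preimage open_open_cells) auto
  have "AE x in lborel. indicator \<Omega> x *\<^sub>R (u x \<bullet> u x) = 0"
    using 0 L unfolding l2_def set_lebesgue_integral_def L2_def set_integrable_def
    by (subst (asm) integral_nonneg_eq_0_iff_AE) (auto simp: indicator_def)
  then have "AE x in lborel. x \<notin> N"
    by eventually_elim (use sub in \<open>auto simp: N_def indicator_def\<close>)
  then have "N \<in> null_sets lborel" using N by (subst AE_iff_null_sets) auto
  then have "negligible N" by (simp add: negligible_iff_null_sets null_sets_completionI)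
  then have "N = {}" using open_not_negligible N by blast
  then show ?thesis
    using u by (auto simp: N_def piecewise_def fun_eq_iff)
qed

section \<open>Conforming spaces\<close>

lemma pd_add:
  assumes "f differentiable (at x)" "g differentiable (at x)"
  shows "pd i (\<lambda>y. f y + g y) x = pd i f x + pd i g x"
  unfolding pd_def
  using frechet_derivative_at[OF has_derivative_add[OF assms[unfolded frechet_derivative_works]]]
  by (metis (no_types, lifting))

lemma pd_scale:
  assumes "f differentiable (at x)"
  shows "pd i (\<lambda>y. c * f y) x = c * pd i f x"
proof -
  have "((\<lambda>y. c *\<^sub>R f y) has_derivative (\<lambda>h. c *\<^sub>R frechet_derivative f (at x) h)) (at x)"
    by (rule has_derivative_scaleR_right[OF assms[unfolded frechet_derivative_works]])
  from frechet_derivative_at[OF this] show ?thesis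
    unfolding pd_def real_scaleR_def by metis
qed

text \<open>
  Linearity is asked only at points of differentiability, because elsewhere the derivatives in
  \<open>grad\<close>, \<open>curl\<close> and \<open>divg\<close> have unspecified values.
\<close>

definition first_order ::
  "((real^3 \<Rightarrow> 'u::euclidean_space) \<Rightarrow> real^3 \<Rightarrow> 'v::euclidean_space) \<Rightarrow> bool" where
  "first_order \<D> \<longleftrightarrow>
     (\<forall>f g x. f differentiable (at x) \<longrightarrow> g differentiable (at x) \<longrightarrow> \<D> (f + g) x = \<D> f x + \<D> g x) \<and>
     (\<forall>c f x. f differentiable (at x) \<longrightarrow> \<D> (c *\<^sub>R f) x = c *\<^sub>R \<D> f x)"

lemma first_order_grad: "first_order grad"
  unfolding first_order_def grad_def
  by (simp add: vec_eq_iff plus_fun_def scaleR_fun_def pd_add pd_scale)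

lemma first_order_curl: "first_order curl"
  unfolding first_order_def curl_def
  by (simp add: vec_eq_iff forall_3 plus_fun_def scaleR_fun_def pd_add pd_scale
      differentiable_component algebra_simps)

lemma first_order_divg: "first_order divg"
  unfolding first_order_def divg_def
  by (simp add: plus_fun_def scaleR_fun_def pd_add pd_scale differentiable_component
      sum.distrib sum_distrib_left)

text \<open>
  The common form of \<open>H1_0_grad\<close>, \<open>H0_curl\<close> and \<open>H0_div\<close>: the pair \<open>(v, g)\<close> lies in the closure of the
  graph of \<open>\<D>\<close> over the test class \<open>Q\<close>.
\<close>

definition graph_closure where
  "graph_closure \<Omega> Q \<D> v g \<longleftrightarrow>
     (\<exists>\<phi>. (\<forall>n. \<phi> n \<in> Q) \<and> L2_tendsto \<Omega> \<phi> v \<and> L2_tendsto \<Omega> (\<lambda>n. \<D> (\<phi> n)) g)"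

lemma smooth_0: "smooth (\<lambda>x. 0)"
proof -
  have "foldr pd is (\<lambda>x. 0) = (\<lambda>x. 0)" for "is"
  proof (induction "is")
    case (Cons i "is")
    have "pd i (\<lambda>x. 0) = (\<lambda>x. 0)" by (simp add: pd_def fun_eq_iff)
    then show ?case by (simp only: foldr.simps comp_apply Cons.IH)
  qed simp
  then show ?thesis by (simp add: smooth_def)
qed

lemma smooth_add:
  assumes f: "smooth f" and g: "smooth g"
  shows "smooth (\<lambda>x. f x + g x)"
proof -
  have "foldr pd is (\<lambda>x. f x + g x) = (\<lambda>x. foldr pd is f x + foldr pd is g x)" for "is"
  proof (induction "is")
    case (Cons i "is")
    have "pd i (\<lambda>x. foldr pd is f x + foldr pd is g x) x = pd i (foldr pd is f) x + pd i (foldr pd is g) x" for x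
      using f g by (intro pd_add) (simp_all add: smooth_def)
    then show ?case by (simp only: foldr.simps comp_apply Cons.IH)
  qed simp
  with f g show ?thesis by (simp add: smooth_def)
qed

lemma smooth_scale:
  assumes f: "smooth f"
  shows "smooth (\<lambda>x. c * f x)"
proof -
  have "foldr pd is (\<lambda>x. c * f x) = (\<lambda>x. c * foldr pd is f x)" for "is"
  proof (induction "is")
    case (Cons i "is")
    have "pd i (\<lambda>x. c * foldr pd is f x) x = c * pd i (foldr pd is f) x" for x
      using f by (intro pd_scale) (simp add: smooth_def)
    then show ?case by (simp only: foldr.simps comp_apply Cons.IH)
  qed simp
  with f show ?thesis by (simp add: smooth_def)
qed

lemma support_subset:
  fixes f :: "'a::t2_space \<Rightarrow> real"
  assumes "compact K" "K \<subseteq> \<Omega>" "{x. f x \<noteq> 0} \<subseteq> K"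
  shows "compact (closure {x. f x \<noteq> (0::real)})" "closure {x. f x \<noteq> 0} \<subseteq> \<Omega>"
proof -
  have sub: "closure {x. f x \<noteq> 0} \<subseteq> K"
    by (rule closure_minimal[OF assms(3) compact_imp_closed[OF assms(1)]])
  show "compact (closure {x. f x \<noteq> 0})"
    using compact_Int_closed[OF assms(1) closed_closure, of "{x. f x \<noteq> 0}"] sub
    by (simp only: inf.absorb2)
  show "closure {x. f x \<noteq> 0} \<subseteq> \<Omega>" using sub assms(2) by (rule subset_trans)
qed

lemma test_function_add:
  assumes "test_function \<Omega> f" "test_function \<Omega> g"
  shows "test_function \<Omega> (\<lambda>x. f x + g x)"
proof -
  let ?K = "closure {x. f x \<noteq> 0} \<union> closure {x. g x \<noteq> 0}"
  have "{x. f x + g x \<noteq> 0} \<subseteq> {x. f x \<noteq> 0} \<union> {x. g x \<noteq> 0}" by auto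
  also have "\<dots> \<subseteq> ?K" by (intro Un_mono closure_subset)
  finally have sub: "{x. f x + g x \<noteq> 0} \<subseteq> ?K" .
  have K: "compact ?K" "?K \<subseteq> \<Omega>"
    using assms unfolding test_function_def by (blast intro: compact_Un)+
  have "smooth (\<lambda>x. f x + g x)"
    by (rule smooth_add) (use assms in \<open>simp_all only: test_function_def\<close>)
  then show ?thesis unfolding test_function_def using support_subset[OF K sub] by blast
qed

lemma test_function_scale:
  assumes "test_function \<Omega> f"
  shows "test_function \<Omega> (\<lambda>x. c * f x)"
proof -
  let ?K = "closure {x. f x \<noteq> 0}"
  have "{x. c * f x \<noteq> 0} \<subseteq> {x. f x \<noteq> 0}" by auto
  also have "\<dots> \<subseteq> ?K" by (rule closure_subset)
  finally have sub: "{x. c * f x \<noteq> 0} \<subseteq> ?K" .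
  have K: "compact ?K" "?K \<subseteq> \<Omega>" using assms unfolding test_function_def by blast+
  have "smooth (\<lambda>x. c * f x)"
    by (rule smooth_scale) (use assms in \<open>simp only: test_function_def\<close>)
  then show ?thesis unfolding test_function_def using support_subset[OF K sub] by blast
qed

lemma test_function_0: "test_function \<Omega> (\<lambda>x. 0)"
  by (simp add: test_function_def smooth_0)

lemma test_function_differentiable: "test_function \<Omega> f \<Longrightarrow> f differentiable (at x)"
  unfolding test_function_def smooth_def by (metis foldr.simps(1) id_apply)

lemma subspace_test_function: "subspace {f. test_function \<Omega> f}"
  by (rule subspaceI)
    (simp_all add: plus_fun_def scaleR_fun_def zero_fun_def test_function_0 test_function_add test_function_scale)

lemma subspace_test_field: "subspace {f. test_field \<Omega> f}"
  by (rule subspaceI)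
    (simp_all add: test_field_def test_function_0 test_function_add test_function_scale)

lemma test_field_differentiable: "test_field \<Omega> f \<Longrightarrow> f differentiable (at x)"
  by (intro differentiable_vecI test_function_differentiable[of \<Omega>]) (simp add: test_field_def)

definition fe_space :: "(real^3) set \<Rightarrow> (real^3 \<Rightarrow> 'v::euclidean_space) set \<Rightarrow> bool" where
  "fe_space \<Omega> X \<longleftrightarrow> subspace X \<and> finite_dimensional X \<and>
     (\<forall>u\<in>X. L2 \<Omega> u) \<and> (\<forall>u\<in>X. l2 \<Omega> u u = 0 \<longrightarrow> u = 0)"

definition L2_linear_on ::
  "(real^3) set \<Rightarrow> (real^3 \<Rightarrow> 'u::euclidean_space) set \<Rightarrow>
   ((real^3 \<Rightarrow> 'u) \<Rightarrow> real^3 \<Rightarrow> 'v::euclidean_space) \<Rightarrow> bool" where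
  "L2_linear_on \<Omega> X d \<longleftrightarrow> (\<forall>u\<in>X. L2 \<Omega> (d u)) \<and>
     (\<forall>u\<in>X. \<forall>v\<in>X. d (u + v) = d u + d v) \<and> (\<forall>c. \<forall>u\<in>X. d (c *\<^sub>R u) = c *\<^sub>R d u)"

lemma L2_linear_on_id: "fe_space \<Omega> X \<Longrightarrow> L2_linear_on \<Omega> X (\<lambda>u. u)"
  by (simp add: fe_space_def L2_linear_on_def)

text \<open>
  One proof for Lagrange, edge and face elements.  The conforming space is closed under linear
  combinations because both ingredients are linear: the classical elementwise operator on piecewise
  differentiable functions, and \<open>\<D>\<close> along sequences of test functions.  The graph closure also
  provides square integrability of the function and of its derivative.
\<close>

lemma conforming_fe_space:
  fixes P :: "(real^3 \<Rightarrow> 'u::euclidean_space) set"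
    and \<D> :: "(real^3 \<Rightarrow> 'u) \<Rightarrow> real^3 \<Rightarrow> 'v::euclidean_space"
  assumes P: "shape_space P" and T: "triangulation T" and sub: "open_cells T \<subseteq> \<Omega>"
    and Q: "subspace Q" and Q_diff: "\<And>\<phi> x. \<phi> \<in> Q \<Longrightarrow> \<phi> differentiable (at x)"
    and D: "first_order \<D>"
    and X: "X = {v \<in> piecewise T P. graph_closure \<Omega> Q \<D> v (elementwise T \<D> v)}"
  shows "fe_space \<Omega> X" "L2_linear_on \<Omega> X (elementwise T \<D>)"
proof -
  let ?d = "elementwise T \<D>"
  have sub_pw: "subspace (piecewise T P)" using P by (intro subspace_piecewise) (simp add: shape_space_def)
  have D_add: "\<D> (f + g) x = \<D> f x + \<D> g x" if "f differentiable (at x)" "g differentiable (at x)" for f g x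
    using D that unfolding first_order_def by blast
  have D_scale: "\<D> (c *\<^sub>R f) x = c *\<^sub>R \<D> f x" if "f differentiable (at x)" for c f x
    using D that unfolding first_order_def by blast
  have D_0: "\<D> 0 x = 0" for x
    using D_scale[of 0 x 0] by (simp add: zero_fun_def)
  have d_add: "?d (u + v) = ?d u + ?d v" if u: "u \<in> piecewise T P" and v: "v \<in> piecewise T P" for u v
  proof (rule ext)
    fix x show "?d (u + v) x = (?d u + ?d v) x"
      using D_add[OF piecewise_differentiable[OF P u] piecewise_differentiable[OF P v]]
      by (simp add: elementwise_def)
  qed
  have d_scale: "?d (c *\<^sub>R u) = c *\<^sub>R ?d u" if u: "u \<in> piecewise T P" for c u
  proof (rule ext)
    fix x show "?d (c *\<^sub>R u) x = (c *\<^sub>R ?d u) x"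
      using D_scale[OF piecewise_differentiable[OF P u]] by (simp add: elementwise_def)
  qed
  have "subspace X"
  proof (rule subspaceI)
    have "?d 0 = 0" "\<D> 0 = 0" by (simp_all only: fun_eq_iff elementwise_def D_0 zero_fun_apply if_cancel simp_thms)
    then have "graph_closure \<Omega> Q \<D> 0 (?d 0)"
      unfolding graph_closure_def using subspace_0[OF Q]
      by (intro exI[of _ "\<lambda>n. 0"]) (simp add: L2_tendsto_zero)
    then show "0 \<in> X" unfolding X using subspace_0[OF sub_pw] by blast
  next
    fix u v assume "u \<in> X" "v \<in> X"
    then have u: "u \<in> piecewise T P" "graph_closure \<Omega> Q \<D> u (?d u)"
      and v: "v \<in> piecewise T P" "graph_closure \<Omega> Q \<D> v (?d v)" unfolding X by blast+
    from u(2) obtain \<phi> where \<phi>: "\<And>n. \<phi> n \<in> Q" "L2_tendsto \<Omega> \<phi> u" "L2_tendsto \<Omega> (\<lambda>n. \<D> (\<phi> n)) (?d u)"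
      unfolding graph_closure_def by blast
    from v(2) obtain \<psi> where \<psi>: "\<And>n. \<psi> n \<in> Q" "L2_tendsto \<Omega> \<psi> v" "L2_tendsto \<Omega> (\<lambda>n. \<D> (\<psi> n)) (?d v)"
      unfolding graph_closure_def by blast
    have "\<D> (\<phi> n + \<psi> n) = \<D> (\<phi> n) + \<D> (\<psi> n)" for n
    proof (rule ext)
      fix x show "\<D> (\<phi> n + \<psi> n) x = (\<D> (\<phi> n) + \<D> (\<psi> n)) x"
        using D_add[OF Q_diff[OF \<phi>(1)] Q_diff[OF \<psi>(1)]] by simp
    qed
    then have "L2_tendsto \<Omega> (\<lambda>n. \<D> (\<phi> n + \<psi> n)) (?d (u + v))"
      unfolding d_add[OF u(1) v(1)] using L2_tendsto_add[OF \<phi>(3) \<psi>(3)] by (simp only:)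
    then have "graph_closure \<Omega> Q \<D> (u + v) (?d (u + v))"
      unfolding graph_closure_def
      using L2_tendsto_add[OF \<phi>(2) \<psi>(2)] subspace_add[OF Q \<phi>(1) \<psi>(1)]
      by (intro exI[of _ "\<lambda>n. \<phi> n + \<psi> n"]) blast
    then show "u + v \<in> X" unfolding X using subspace_add[OF sub_pw u(1) v(1)] by blast
  next
    fix c :: real and u assume "u \<in> X"
    then have u: "u \<in> piecewise T P" "graph_closure \<Omega> Q \<D> u (?d u)" unfolding X by blast+
    from u(2) obtain \<phi> where \<phi>: "\<And>n. \<phi> n \<in> Q" "L2_tendsto \<Omega> \<phi> u" "L2_tendsto \<Omega> (\<lambda>n. \<D> (\<phi> n)) (?d u)"
      unfolding graph_closure_def by blast
    have "\<D> (c *\<^sub>R \<phi> n) = c *\<^sub>R \<D> (\<phi> n)" for n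
    proof (rule ext)
      fix x show "\<D> (c *\<^sub>R \<phi> n) x = (c *\<^sub>R \<D> (\<phi> n)) x"
        using D_scale[OF Q_diff[OF \<phi>(1)]] by simp
    qed
    then have "L2_tendsto \<Omega> (\<lambda>n. \<D> (c *\<^sub>R \<phi> n)) (?d (c *\<^sub>R u))"
      unfolding d_scale[OF u(1)] using L2_tendsto_scale[OF \<phi>(3)] by (simp only:)
    then have "graph_closure \<Omega> Q \<D> (c *\<^sub>R u) (?d (c *\<^sub>R u))"
      unfolding graph_closure_def
      using L2_tendsto_scale[OF \<phi>(2)] subspace_scale[OF Q \<phi>(1)]
      by (intro exI[of _ "\<lambda>n. c *\<^sub>R \<phi> n"]) blast
    then show "c *\<^sub>R u \<in> X" unfolding X using subspace_scale[OF sub_pw u(1)] by blast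
  qed
  moreover have "finite_dimensional X"
  proof (rule finite_dimensional_mono)
    show "finite_dimensional (piecewise T P)"
      using P by (intro finite_dimensional_piecewise[OF T]) (simp add: shape_space_def)
  qed (auto simp: X)
  moreover have L: "L2 \<Omega> u" "L2 \<Omega> (?d u)" if "u \<in> X" for u
    using that by (auto simp: X graph_closure_def L2_tendsto_def)
  moreover have "u = 0" if "u \<in> X" "l2 \<Omega> u u = 0" for u
    using piecewise_definite[OF P _ sub L(1)] that X by blast
  ultimately show "fe_space \<Omega> X" unfolding fe_space_def by blast
  show "L2_linear_on \<Omega> X ?d"
    unfolding L2_linear_on_def using L(2) d_add d_scale X by blast
qed

section \<open>The discrete operators\<close>

lemma L2_functional_dual:
  assumes X: "subspace X" and d: "L2_linear_on \<Omega> X d" and w: "L2 \<Omega> w"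
  shows "functional X (\<lambda>x. l2 \<Omega> w (d x)) \<in> dual X"
  using assms unfolding L2_linear_on_def
  by (intro dualI)
    (simp_all add: functional_def subspace_add subspace_scale l2_add_right l2_scale_right)

lemma spd_form_mass:
  assumes X: "fe_space \<Omega> X"
  shows "spd_form X (mass \<Omega> X)"
proof
  note X' = X[unfolded fe_space_def]
  show "subspace X" using X' by blast
  show "finite_dimensional X" using X' by blast
  show "mass \<Omega> X x \<in> dual X" if "x \<in> X" for x
    unfolding mass_def using X' that by (intro L2_functional_dual L2_linear_on_id[OF X]) auto
  show "mass \<Omega> X x y = mass \<Omega> X y x" if "x \<in> X" "y \<in> X" for x y
    using that by (simp add: mass_def functional_def l2_commute)
  show "0 \<le> mass \<Omega> X x x" if "x \<in> X" for x
    using that by (simp add: mass_def functional_def l2_nonneg)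
  show "x = 0" if "x \<in> X" "mass \<Omega> X x x = 0" for x
    using that X' by (simp add: mass_def functional_def)
qed

text \<open>
  Two consecutive operators \<open>d\<close>, \<open>d'\<close> of a discrete complex that is exact in between give a saddle
  point system.  Exactness makes the Schur complement definite: a \<open>v\<close> with \<open>d' v = 0\<close> is
  some \<open>d \<sigma>\<close>, and \<open>B v = 0\<close> tested with this \<open>\<sigma>\<close> gives \<open>(v, v) = 0\<close>.
\<close>

lemma hodge_saddle_system:
  assumes X: "fe_space \<Omega> X" and Y: "fe_space \<Omega> Y"
    and d: "L2_linear_on \<Omega> X d" and d': "L2_linear_on \<Omega> Y d'"
    and d'_definite: "\<And>v. v \<in> Y \<Longrightarrow> l2 \<Omega> (d' v) (d' v) = 0 \<Longrightarrow> d' v = 0"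
    and exact: "d ` X = {v \<in> Y. d' v = 0}"
    and B: "\<And>v. v \<in> Y \<Longrightarrow> B v = functional X (\<lambda>\<tau>. l2 \<Omega> v (d \<tau>))"
    and Bt: "\<And>\<sigma>. \<sigma> \<in> X \<Longrightarrow> Bt \<sigma> = functional Y (\<lambda>v. l2 \<Omega> (d \<sigma>) v)"
    and D: "\<And>v. v \<in> Y \<Longrightarrow> D v = functional Y (\<lambda>w. l2 \<Omega> (d' v) (d' w))"
  shows "saddle_system X (mass \<Omega> X) Y B Bt D"
proof (intro saddle_system.intro spd_form_mass[OF X] saddle_system_axioms.intro)
  note X' = X[unfolded fe_space_def] and Y' = Y[unfolded fe_space_def]
  have Ld: "L2 \<Omega> (d \<sigma>)" if "\<sigma> \<in> X" for \<sigma> using d that by (simp add: L2_linear_on_def)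
  have Ld': "L2 \<Omega> (d' v)" if "v \<in> Y" for v using d' that by (simp add: L2_linear_on_def)
  show "subspace Y" using Y' by blast
  show "finite_dimensional Y" using Y' by blast
  show "B v \<in> dual X" if "v \<in> Y" for v
    unfolding B[OF that] using X' Y' that by (intro L2_functional_dual d) auto
  show "Bt \<sigma> \<in> dual Y" if "\<sigma> \<in> X" for \<sigma>
    unfolding Bt[OF that] using Y' Ld[OF that] by (intro L2_functional_dual L2_linear_on_id[OF Y]) auto
  show "Bt \<sigma> v = B v \<sigma>" if "\<sigma> \<in> X" "v \<in> Y" for \<sigma> v
    using that by (simp add: B Bt functional_def l2_commute)
  show "D v \<in> dual Y" if "v \<in> Y" for v
    unfolding D[OF that] using Y' Ld'[OF that] by (intro L2_functional_dual d') auto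
  show "D v w = D w v" if "v \<in> Y" "w \<in> Y" for v w
    using that by (simp add: D functional_def l2_commute)
  show "0 \<le> D v v" if "v \<in> Y" for v
    using that by (simp add: D functional_def l2_nonneg)
  show "v = 0" if v: "v \<in> Y" and B0: "\<And>\<sigma>. \<sigma> \<in> X \<Longrightarrow> B v \<sigma> = 0" and D0: "D v v = 0" for v
  proof -
    have "d' v = 0" using D0 v d'_definite[OF v] by (simp add: D functional_def)
    then obtain \<sigma> where \<sigma>: "\<sigma> \<in> X" "v = d \<sigma>" using exact v by blast
    have "l2 \<Omega> v v = l2 \<Omega> v (d \<sigma>)" by (simp only: \<sigma>(2)[symmetric])
    also have "\<dots> = B v \<sigma>" using \<sigma>(1) by (simp only: B[OF v] functional_def if_True)
    also have "\<dots> = 0" by (rule B0[OF \<sigma>(1)])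
    finally show "v = 0" using Y' v by blast
  qed
qed

lemma H1_0_grad_eq: "H1_0_grad \<Omega> = graph_closure \<Omega> {f. test_function \<Omega> f} grad"
  by (intro ext) (simp only: H1_0_grad_def graph_closure_def mem_Collect_eq)

lemma H0_curl_eq: "H0_curl \<Omega> = graph_closure \<Omega> {f. test_field \<Omega> f} curl"
  by (intro ext) (simp only: H0_curl_def graph_closure_def mem_Collect_eq)

lemma H0_div_eq: "H0_div \<Omega> = graph_closure \<Omega> {f. test_field \<Omega> f} divg"
  by (intro ext) (simp only: H0_div_def graph_closure_def mem_Collect_eq)

lemma transp_functional:
  assumes "\<And>v. v \<in> Y \<Longrightarrow> B v = functional X (b v)" and "\<sigma> \<in> X"
  shows "transp Y B \<sigma> = functional Y (\<lambda>v. b v \<sigma>)"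
  using assms by (auto simp: transp_def functional_def fun_eq_iff)

context
  fixes \<Omega> :: "(real^3) set" and T :: mesh
  assumes \<Omega>: "convex_polyhedral_domain \<Omega>" and T: "mesh_of \<Omega> T"
begin

lemma mesh_triangulation: "triangulation T"
  using T by (simp add: mesh_of_def)

lemma lagrange_fe_space:
  "fe_space \<Omega> (lagrange_space \<Omega> T r)" "L2_linear_on \<Omega> (lagrange_space \<Omega> T r) (grad_h T)"
  by (rule conforming_fe_space[OF shape_space_polys mesh_triangulation open_cells_subset[OF \<Omega> T]
        subspace_test_function _ first_order_grad lagrange_space_def[unfolded H1_0_grad_eq]];
      simp only: mem_Collect_eq test_function_differentiable)+

lemma edge_fe_space:
  "fe_space \<Omega> (edge_space \<Omega> T e)" "L2_linear_on \<Omega> (edge_space \<Omega> T e) (curl_h T)"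
  by (rule conforming_fe_space[OF shape_space_edge mesh_triangulation open_cells_subset[OF \<Omega> T]
        subspace_test_field _ first_order_curl edge_space_def[unfolded H0_curl_eq]];
      simp only: mem_Collect_eq test_field_differentiable)+

lemma face_fe_space:
  "fe_space \<Omega> (face_space \<Omega> T f)" "L2_linear_on \<Omega> (face_space \<Omega> T f) (div_h T)"
  by (rule conforming_fe_space[OF shape_space_face mesh_triangulation open_cells_subset[OF \<Omega> T]
        subspace_test_field _ first_order_divg face_space_def[unfolded H0_div_eq]];
      simp only: mem_Collect_eq test_field_differentiable)+

context
  fixes r s :: nat and e f and S U V W
  assumes S: "S = lagrange_space \<Omega> T r" and U: "U = edge_space \<Omega> T e"
    and V: "V = face_space \<Omega> T f" and W: "W = dg_space \<Omega> T s"
    and exact: "exact_complex T S U V W"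
begin

lemma curl_system:
  "saddle_system S (mass \<Omega> S) U (B_op \<Omega> T S) (transp U (B_op \<Omega> T S)) (curl_curl \<Omega> T U)"
proof (rule hodge_saddle_system)
  show "fe_space \<Omega> S" "L2_linear_on \<Omega> S (grad_h T)" unfolding S by (rule lagrange_fe_space)+
  show "fe_space \<Omega> U" "L2_linear_on \<Omega> U (curl_h T)" unfolding U by (rule edge_fe_space)+
  show "grad_h T ` S = {v \<in> U. curl_h T v = 0}"
    using exact by (simp add: exact_complex_def zero_fun_def)
  show "curl_h T v = 0" if v: "v \<in> U" and 0: "l2 \<Omega> (curl_h T v) (curl_h T v) = 0" for v
  proof -
    \<comment> \<open>the curl lies in the next space of the complex, where the form is definite\<close>
    have "curl_h T v \<in> V" using exact v unfolding exact_complex_def by blast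
    then show ?thesis using face_fe_space(1)[of f] 0 unfolding V fe_space_def by blast
  qed
  show "transp U (B_op \<Omega> T S) \<sigma> = functional U (\<lambda>v. l2 \<Omega> (grad_h T \<sigma>) v)" if "\<sigma> \<in> S" for \<sigma>
    using that unfolding l2_commute[of \<Omega> "grad_h T \<sigma>"]
    by (intro transp_functional[where X = S]) (simp add: B_op_def)
qed (simp_all only: B_op_def curl_curl_def)

lemma div_system:
  "saddle_system U (mass \<Omega> U) V (transp U (C_op \<Omega> T V)) (C_op \<Omega> T V) (div_div \<Omega> T V)"
proof (rule hodge_saddle_system)
  show "fe_space \<Omega> U" "L2_linear_on \<Omega> U (curl_h T)" unfolding U by (rule edge_fe_space)+
  show "fe_space \<Omega> V" and d: "L2_linear_on \<Omega> V (div_h T)" unfolding V by (rule face_fe_space)+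
  show "curl_h T ` U = {v \<in> V. div_h T v = 0}"
    using exact by (simp add: exact_complex_def zero_fun_def)
  show "div_h T v = 0" if v: "v \<in> V" and 0: "l2 \<Omega> (div_h T v) (div_h T v) = 0" for v
  proof -
    \<comment> \<open>the divergence is again a piecewise polynomial\<close>
    have "div_h T v \<in> W" using exact v unfolding exact_complex_def by blast
    then have "div_h T v \<in> piecewise T (polys s)" unfolding W dg_space_def by blast
    then show ?thesis
      using d v 0 unfolding L2_linear_on_def
      by (intro piecewise_definite[OF shape_space_polys _ open_cells_subset[OF \<Omega> T]]) blast+
  qed
  show "transp U (C_op \<Omega> T V) v = functional U (\<lambda>\<tau>. l2 \<Omega> v (curl_h T \<tau>))" if "v \<in> V" for v
    using that unfolding l2_commute[of \<Omega> v]
    by (intro transp_functional[where X = V]) (simp add: C_op_def)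
qed (simp_all only: C_op_def div_div_def)

end
end

theorem theorem4p3:
  fixes \<Omega> :: "(real^3) set" and H :: "real set" and T :: "real \<Rightarrow> mesh"
    and r s :: nat and e :: edge_element and f :: face_element
    and S :: "real \<Rightarrow> (real^3 \<Rightarrow> real) set"
    and U V :: "real \<Rightarrow> (real^3 \<Rightarrow> real^3) set"
    and W :: "real \<Rightarrow> (real^3 \<Rightarrow> real) set"
  assumes "S = (\<lambda>h. lagrange_space \<Omega> (T h) r)"
    and "U = (\<lambda>h. edge_space \<Omega> (T h) e)"
    and "V = (\<lambda>h. face_space \<Omega> (T h) f)"
    and "W = (\<lambda>h. dg_space \<Omega> (T h) s)"
    and "convex_polyhedral_domain \<Omega>"
    and "regular_mesh_family \<Omega> H T"
    and "r \<ge> 1" and "edge_degree e \<ge> 1" and "face_degree f \<ge> 1"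
    and "\<And>h. h \<in> H \<Longrightarrow> exact_complex (T h) (S h) (U h) (V h) (W h)"
  shows
    "(\<forall>h\<in>H. bij_betw (L_curl \<Omega> (T h) (S h) (U h)) (S h \<times> U h) (dual (S h) \<times> dual (U h))) \<and>
     (\<forall>h\<in>H. bij_betw (L_div \<Omega> (T h) (U h) (V h)) (U h \<times> V h) (dual (U h) \<times> dual (V h))) \<and>
     (\<exists>C. \<forall>h\<in>H. op_norm_le (S h \<times> U h)
        (pair_norm (energy_norm (mass \<Omega> (S h))) (energy_norm (A_curl \<Omega> (T h) (S h) (U h))))
        (pair_norm (dual_norm (S h) (mass \<Omega> (S h))) (dual_norm (U h) (A_curl \<Omega> (T h) (S h) (U h))))
        (L_curl \<Omega> (T h) (S h) (U h)) C) \<and>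
     (\<exists>C. \<forall>h\<in>H. op_norm_le (U h \<times> V h)
        (pair_norm (energy_norm (mass \<Omega> (U h))) (energy_norm (A_div \<Omega> (T h) (U h) (V h))))
        (pair_norm (dual_norm (U h) (mass \<Omega> (U h))) (dual_norm (V h) (A_div \<Omega> (T h) (U h) (V h))))
        (L_div \<Omega> (T h) (U h) (V h)) C) \<and>
     (\<exists>C. \<forall>h\<in>H. op_norm_le (dual (S h) \<times> dual (U h))
        (pair_norm (dual_norm (S h) (mass \<Omega> (S h))) (dual_norm (U h) (A_curl \<Omega> (T h) (S h) (U h))))
        (pair_norm (energy_norm (mass \<Omega> (S h))) (energy_norm (A_curl \<Omega> (T h) (S h) (U h))))
        (inv_into (S h \<times> U h) (L_curl \<Omega> (T h) (S h) (U h))) C) \<and>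
     (\<exists>C. \<forall>h\<in>H. op_norm_le (dual (U h) \<times> dual (V h))
        (pair_norm (dual_norm (U h) (mass \<Omega> (U h))) (dual_norm (V h) (A_div \<Omega> (T h) (U h) (V h))))
        (pair_norm (energy_norm (mass \<Omega> (U h))) (energy_norm (A_div \<Omega> (T h) (U h) (V h))))
        (inv_into (U h \<times> V h) (L_div \<Omega> (T h) (U h) (V h))) C)"
proof -
  have mesh: "mesh_of \<Omega> (T h)" if "h \<in> H" for h
    using assms(6) that by (simp add: regular_mesh_family_def)
  have c: "saddle_system (S h) (mass \<Omega> (S h)) (U h) (B_op \<Omega> (T h) (S h))
      (transp (U h) (B_op \<Omega> (T h) (S h))) (curl_curl \<Omega> (T h) (U h))" if h: "h \<in> H" for h
    by (rule curl_system[OF assms(5) mesh[OF h] _ _ _ _ assms(10)[OF h]]) (simp_all only: assms(1-4))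
  have d: "saddle_system (U h) (mass \<Omega> (U h)) (V h) (transp (U h) (C_op \<Omega> (T h) (V h)))
      (C_op \<Omega> (T h) (V h)) (div_div \<Omega> (T h) (V h))" if h: "h \<in> H" for h
    by (rule div_system[OF assms(5) mesh[OF h] _ _ _ _ assms(10)[OF h]]) (simp_all only: assms(1-4))
  show ?thesis
    unfolding L_curl_def L_div_def A_curl_def A_div_def
    using saddle_system.bij_L[OF c] saddle_system.bij_L[OF d]
      saddle_system.L_bound[OF c] saddle_system.L_bound[OF d]
      saddle_system.L_inverse_bound[OF c] saddle_system.L_inverse_bound[OF d] by blast
qed

end
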